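(* Let $\mathcal G$ be a finite nonempty collection of allowed words of $\Sigma_A$, all of length $2$, and let $\phi_P:\Sigma_A\to\mathbb R$ be $\phi_P(x)=\ln P_{x_1x_2}$. Then $$\rho(H_{\mathcal G})=\mathcal P_A(\phi_P)-\mathcal P_{B_{\mathcal G}}(\phi_P),$$ where $\mathcal P_A(\phi_P)$ is the topological pressure of $\phi_P$ on $(\Sigma_A,\sigma)$ and $\mathcal P_{B_{\mathcal G}}(\phi_P)$ is the topological pressure of the restriction of $\phi_P$ to $(\Sigma_{B_{\mathcal G}},\sigma)$ (with the convention that the pressure is $-\infty$ if $\Sigma_{B_{\mathcal G}}=\emptyset$, and $-\ln 0=+\infty$).
   Context: Let $\Sigma=\{1,\dots,N\}$, $A$ an irreducible $N\times N$ $0$–$1$ matrix, $\Sigma_A=\{x\in\Sigma^{\mathbb N}:A_{x_nx_{n+1}}=1\ \forall n\}$ with left shift $\sigma$; $\mathcal L_2$ is the set of allowed words of length $2$ (occurring in some element of $\Sigma_A$); $C_w$ is the set of $x\in\Sigma_A$ beginning with $w$. $P$ is a row-stochastic matrix with $P_{ij}>0$ iff $A_{ij}=1$, $\mathbf p$ its stationary vector, $\mu=\mu_P$ the Markov measure $\mu(C_w)=p_{w_1}P_{w_1w_2}\cdots P_{w_{n-1}w_n}$. $H_{\mathcal G}=\bigcup_{w\in\mathcal G}C_w$; $\mathcal W_m=\{x:\sigma^ix\notin H_{\mathcal G},0\le i\le m\}$, $\rho(H_{\mathcal G})=-\lim_m\frac1m\ln\mu(\mathcal W_m)$. Since all words in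 $\mathcal G$ have length 2, $B_{\mathcal G}$ is the $0$–$1$ matrix indexed by $\Sigma$ with $(B_{\mathcal G})_{ij}=1$ iff $ij\in\mathcal L_2$ and $ij\notin\mathcal G$; $\Sigma_{B_{\mathcal G}}=\{x\in\Sigma^{\mathbb N}:(B_{\mathcal G})_{x_nx_{n+1}}=1\ \forall n\}\subseteq\Sigma_A$. For a compact shift-invariant $Y\subseteq\Sigma_A$ and continuous $\phi$, the pressure is $\sup\{h_\nu(\sigma)+\int_Y\phi\,d\nu\}$ over $\sigma$-invariant Borel probability measures $\nu$ on $Y$, $h_\nu$ being measure-theoretic entropy. *)

theory Defs
  imports "HOL-Probability.Probability"
begin

text \<open>Alphabet is {1..N}; matrices are functions nat => nat => real, only
  entries with indices in {1..N} matter. Sequences x : nat => nat, indexed from 0.\<close>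

fun mat_pow :: "nat \<Rightarrow> (nat \<Rightarrow> nat \<Rightarrow> real) \<Rightarrow> nat \<Rightarrow> nat \<Rightarrow> nat \<Rightarrow> real" where
  "mat_pow N M 0 i j = (if i = j then 1 else 0)"
| "mat_pow N M (Suc n) i j = (\<Sum>k\<in>{1..N}. mat_pow N M n i k * M k j)"

definition zero_one_matrix :: "nat \<Rightarrow> (nat \<Rightarrow> nat \<Rightarrow> real) \<Rightarrow> bool" where
  "zero_one_matrix N M \<longleftrightarrow> (\<forall>i\<in>{1..N}. \<forall>j\<in>{1..N}. M i j = 0 \<or> M i j = 1)"

definition irreducible_matrix :: "nat \<Rightarrow> (nat \<Rightarrow> nat \<Rightarrow> real) \<Rightarrow> bool" where
  "irreducible_matrix N M \<longleftrightarrow>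
     (\<forall>i\<in>{1..N}. \<forall>j\<in>{1..N}. \<exists>n\<ge>1. mat_pow N M n i j > 0)"

definition row_stochastic :: "nat \<Rightarrow> (nat \<Rightarrow> nat \<Rightarrow> real) \<Rightarrow> bool" where
  "row_stochastic N P \<longleftrightarrow>
     (\<forall>i\<in>{1..N}. (\<forall>j\<in>{1..N}. P i j \<ge> 0) \<and> (\<Sum>j\<in>{1..N}. P i j) = 1)"

definition stationary_vector :: "nat \<Rightarrow> (nat \<Rightarrow> nat \<Rightarrow> real) \<Rightarrow> (nat \<Rightarrow> real) \<Rightarrow> bool" where
  "stationary_vector N P p \<longleftrightarrow>
     (\<forall>i\<in>{1..N}. p i \<ge> 0) \<and> (\<Sum>i\<in>{1..N}. p i) = 1 \<and>
     (\<forall>j\<in>{1..N}. (\<Sum>i\<in>{1..N}. p i * P i j) = p j)"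

definition shift_space :: "nat \<Rightarrow> (nat \<Rightarrow> nat \<Rightarrow> real) \<Rightarrow> (nat \<Rightarrow> nat) set" where
  "shift_space N M = {x. (\<forall>n. x n \<in> {1..N}) \<and> (\<forall>n. M (x n) (x (Suc n)) = 1)}"

definition shift :: "(nat \<Rightarrow> nat) \<Rightarrow> (nat \<Rightarrow> nat)" where
  "shift x = (\<lambda>n. x (Suc n))"

text \<open>Full shift space Sigma^N with its Borel (= product) sigma algebra.\<close>
definition full_shift_measure :: "nat \<Rightarrow> (nat \<Rightarrow> nat) measure" where
  "full_shift_measure N = PiM UNIV (\<lambda>_. count_space {1..N})"

definition allowed_word :: "nat \<Rightarrow> (nat \<Rightarrow> nat \<Rightarrow> real) \<Rightarrow> nat list \<Rightarrow> bool" where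
  "allowed_word N A w \<longleftrightarrow>
     (\<exists>x\<in>shift_space N A. \<exists>n. \<forall>i<length w. x (n + i) = w ! i)"

definition cylinder :: "nat \<Rightarrow> (nat \<Rightarrow> nat \<Rightarrow> real) \<Rightarrow> nat list \<Rightarrow> (nat \<Rightarrow> nat) set" where
  "cylinder N A w = {x\<in>shift_space N A. \<forall>i<length w. x i = w ! i}"

definition markov_measure :: "nat \<Rightarrow> (nat \<Rightarrow> nat \<Rightarrow> real) \<Rightarrow> (nat \<Rightarrow> nat \<Rightarrow> real)
     \<Rightarrow> (nat \<Rightarrow> real) \<Rightarrow> (nat \<Rightarrow> nat) measure \<Rightarrow> bool" where
  "markov_measure N A P p \<mu> \<longleftrightarrow>
     prob_space \<mu> \<and> sets \<mu> = sets (full_shift_measure N) \<and>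
     (\<forall>w. w \<noteq> [] \<and> set w \<subseteq> {1..N} \<longrightarrow>
        emeasure \<mu> (cylinder N A w) =
          ennreal (p (w ! 0) * (\<Prod>i<length w - 1. P (w ! i) (w ! Suc i))))"

definition hole :: "nat \<Rightarrow> (nat \<Rightarrow> nat \<Rightarrow> real) \<Rightarrow> nat list set \<Rightarrow> (nat \<Rightarrow> nat) set" where
  "hole N A G = (\<Union>w\<in>G. cylinder N A w)"

definition survivor :: "nat \<Rightarrow> (nat \<Rightarrow> nat \<Rightarrow> real) \<Rightarrow> nat list set \<Rightarrow> nat \<Rightarrow> (nat \<Rightarrow> nat) set" where
  "survivor N A G m = {x\<in>shift_space N A. \<forall>i\<le>m. (shift ^^ i) x \<notin> hole N A G}"

definition hole_matrix :: "nat \<Rightarrow> (nat \<Rightarrow> nat \<Rightarrow> real) \<Rightarrow> nat list set \<Rightarrow> nat \<Rightarrow> nat \<Rightarrow> real" where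
  "hole_matrix N A G i j = (if allowed_word N A [i, j] \<and> [i, j] \<notin> G then 1 else 0)"

definition partition_entropy :: "'a measure \<Rightarrow> 'a set set \<Rightarrow> real" where
  "partition_entropy \<nu> Q = (\<Sum>S\<in>Q. - measure \<nu> S * ln (measure \<nu> S))"

definition iterated_join :: "'a measure \<Rightarrow> ('a \<Rightarrow> 'a) \<Rightarrow> 'a set set \<Rightarrow> nat \<Rightarrow> 'a set set" where
  "iterated_join \<nu> T Q n =
     {space \<nu> \<inter> (\<Inter>i<n. (T ^^ i) -` f i) | f. \<forall>i<n. f i \<in> Q}"

definition finite_measurable_partitions :: "'a measure \<Rightarrow> 'a set set set" where
  "finite_measurable_partitions \<nu> =
     {Q. finite Q \<and> Q \<subseteq> sets \<nu> \<and> disjoint Q \<and> \<Union>Q = space \<nu>}"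

definition ks_entropy :: "'a measure \<Rightarrow> ('a \<Rightarrow> 'a) \<Rightarrow> ereal" where
  "ks_entropy \<nu> T = (SUP Q\<in>finite_measurable_partitions \<nu>.
       ereal (lim (\<lambda>n. partition_entropy \<nu> (iterated_join \<nu> T Q n) / real n)))"

text \<open>Shift-invariant Borel probability measures on a (compact shift-invariant) Y,
  represented as Borel probability measures on Sigma^N concentrated on Y.\<close>
definition invariant_measures_on :: "nat \<Rightarrow> (nat \<Rightarrow> nat) set \<Rightarrow> (nat \<Rightarrow> nat) measure set" where
  "invariant_measures_on N Y =
     {\<nu>. prob_space \<nu> \<and> sets \<nu> = sets (full_shift_measure N) \<and> emeasure \<nu> Y = 1 \<and>
          shift \<in> measurable \<nu> \<nu> \<and> distr \<nu> \<nu> shift = \<nu>}"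

text \<open>Topological pressure via the variational formula; -\<infinity> if there is no measure.\<close>
definition pressure :: "nat \<Rightarrow> (nat \<Rightarrow> nat) set \<Rightarrow> ((nat \<Rightarrow> nat) \<Rightarrow> real) \<Rightarrow> ereal" where
  "pressure N Y \<phi> = (SUP \<nu>\<in>invariant_measures_on N Y.
       ks_entropy \<nu> shift + ereal (\<integral>x. \<phi> x \<partial>\<nu>))"

definition escape_seq :: "(nat \<Rightarrow> nat) measure \<Rightarrow> ((nat \<Rightarrow> nat) set) \<Rightarrow> ereal" where
  "escape_seq \<mu> W = (if measure \<mu> W = 0 then \<infinity> else ereal (- ln (measure \<mu> W)))"

end

theory Submission
  imports Defs
begin

text \<open>
  Let \<open>W\<close> be the matrix \<open>P\<close> with the entries outside a transition matrix \<open>B\<close> set to \<open>0\<close>, and let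
  \<open>Z\<^sub>n\<close> be the total \<open>W\<close>-weight of all words with \<open>n\<close> edges. The measure of the survivor set is
  \<open>Z\<^sub>m\<^sub>+\<^sub>1\<close> up to a factor bounded away from \<open>0\<close> and \<open>\<infinity>\<close>, so the theorem amounts to the variational
  principle: the pressure on \<open>\<Sigma>\<^sub>B\<close> is \<open>lim (ln Z\<^sub>n) / n\<close>. (For \<open>B = A\<close> one has \<open>Z\<^sub>n = N\<close> and
  pressure \<open>0\<close>.) Both inequalities come from Gibbs' inequality
  \<open>\<Sum> p ln q \<le> \<Sum> p ln p\<close>.

  Upper bound: a finite measurable partition is determined by the first \<open>k\<close> letters outside a set of
  small measure. Comparing the joint law of itinerary and letters with the law that draws letters
  proportionally to their weight and then guesses the itinerary from windows of \<open>k\<close> letters bounds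
  the entropy of the itinerary by \<open>ln Z\<^sub>n - n \<integral>\<phi> + n \<epsilon>\<close>.

  Lower bound: let \<open>q\<^sub>n\<close> be the average law of an edge of a random word of length \<open>n + 1\<close> drawn
  proportionally to its weight. Comparing with the Markov chain that has edge law \<open>q\<^sub>n\<close> gives
  \<open>ln Z\<^sub>n \<le> ln N + n F(q\<^sub>n)\<close>, where \<open>F(q)\<close> is the entropy plus the integral of \<open>\<phi>\<close> for that chain.
  A limit point \<open>q\<close> of \<open>q\<^sub>n\<close> is stationary, and the Markov measure with edge law \<open>q\<close> is an invariant
  measure on \<open>\<Sigma>\<^sub>B\<close>.
\<close>

section \<open>Words, Gibbs' inequality and subadditive sequences\<close>

definition words :: "'a set \<Rightarrow> nat \<Rightarrow> 'a list set" where
  "words S n = {w. set w \<subseteq> S \<and> length w = n}"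

lemma finite_words [simp]: "finite S \<Longrightarrow> finite (words S n)"
  unfolding words_def by (rule finite_lists_length_eq)

lemma words_0 [simp]: "words S 0 = {[]}"
  by (auto simp: words_def)

lemma length_words: "w \<in> words S n \<Longrightarrow> length w = n"
  by (simp add: words_def)

lemma nth_words: "w \<in> words S n \<Longrightarrow> i < n \<Longrightarrow> w ! i \<in> S"
  unfolding words_def using nth_mem by blast

lemma sum_words_append:
  "(\<Sum>w\<in>words S (m + n). f w) = (\<Sum>u\<in>words S m. \<Sum>v\<in>words S n. f (u @ v))"
proof -
  have "(\<Sum>w\<in>words S (m + n). f w) = (\<Sum>(u, v)\<in>words S m \<times> words S n. f (u @ v))"
    by (rule sum.reindex_bij_witness[where i = "\<lambda>(u, v). u @ v" and j = "\<lambda>w. (take m w, drop m w)"])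
      (auto simp: words_def dest: in_set_takeD in_set_dropD)
  then show ?thesis
    by (simp add: sum.cartesian_product)
qed

lemma sum_words_1: "(\<Sum>w\<in>words S (Suc 0). f w) = (\<Sum>a\<in>S. f [a])"
  by (rule sum.reindex_bij_witness[where i = "\<lambda>a. [a]" and j = hd])
    (auto simp: words_def length_Suc_conv)

lemma sum_words_Suc:
  "(\<Sum>w\<in>words S (Suc n). f w) = (\<Sum>w\<in>words S n. \<Sum>a\<in>S. f (w @ [a]))"
  using sum_words_append[of f S n "Suc 0"] by (simp add: sum_words_1)

lemma sum_words_prod:
  fixes f :: "nat \<Rightarrow> 'a \<Rightarrow> real"
  shows "(\<Sum>w\<in>words S n. \<Prod>i<n. f i (w ! i)) = (\<Prod>i<n. \<Sum>a\<in>S. f i a)"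
proof (induction n)
  case (Suc n)
  have "(\<Sum>w\<in>words S (Suc n). \<Prod>i<Suc n. f i (w ! i))
      = (\<Sum>w\<in>words S n. \<Sum>a\<in>S. (\<Prod>i<n. f i (w ! i)) * f n a)"
    unfolding sum_words_Suc by (intro sum.cong refl) (simp add: nth_append length_words)
  also have "\<dots> = (\<Sum>w\<in>words S n. \<Prod>i<n. f i (w ! i)) * (\<Sum>a\<in>S. f n a)"
    by (simp add: sum_product)
  finally show ?case
    using Suc by simp
qed simp

text \<open>Termwise this is \<open>ln x \<le> x - 1\<close> at \<open>x = q i / p i\<close>; the
  sum gives the claim. Because \<open>ln 0 = 0\<close>, the third assumption has to exclude a
  vanishing \<open>q i\<close> against a positive \<open>p i\<close>. The last assumption lets
  \<open>q\<close> be a sub-probability when \<open>p\<close> is a probability.\<close>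

lemma gibbs_inequality:
  fixes p q :: "'a \<Rightarrow> real"
  assumes "\<And>i. i \<in> I \<Longrightarrow> 0 \<le> p i" and "\<And>i. i \<in> I \<Longrightarrow> 0 \<le> q i"
    and "\<And>i. i \<in> I \<Longrightarrow> 0 < p i \<Longrightarrow> 0 < q i" and "sum q I \<le> sum p I"
  shows "(\<Sum>i\<in>I. p i * ln (q i)) \<le> (\<Sum>i\<in>I. p i * ln (p i))"
proof -
  have "p i * ln (q i) - p i * ln (p i) \<le> q i - p i" if "i \<in> I" for i
  proof (cases "p i = 0")
    case True
    then show ?thesis using assms(2)[OF that] by simp
  next
    case False
    then have pos: "0 < p i" "0 < q i"
      using assms(1,3)[OF that] by auto
    then have "p i * ln (q i / p i) \<le> p i * (q i / p i - 1)"
      by (intro mult_left_mono ln_le_minus_one) auto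
    then show ?thesis
      using pos by (simp add: ln_div algebra_simps)
  qed
  then have "(\<Sum>i\<in>I. p i * ln (q i) - p i * ln (p i)) \<le> (\<Sum>i\<in>I. q i - p i)"
    by (rule sum_mono)
  then show ?thesis
    using assms(4) by (simp add: sum_subtractf)
qed

text \<open>Fekete's lemma: the quotients converge to their infimum, since division with remainder
  by a nearly optimal \<open>k\<close> bounds every later quotient.\<close>

lemma fekete_convergent:
  fixes u :: "nat \<Rightarrow> real"
  assumes nn: "\<And>n. 0 \<le> u n" and sub: "\<And>m n. u (m + n) \<le> u m + u n"
  shows "convergent (\<lambda>n. u n / real n)"
proof -
  \<comment> \<open>The index \<open>0\<close> is left out because \<open>u 0 / real 0\<close> is
    \<open>0\<close> and would spoil the infimum.\<close>
  define L where "L = (INF n\<in>{1..}. u n / real n)"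
  have bdd: "bdd_below ((\<lambda>n. u n / real n) ` {1..})"
    by (rule bdd_belowI[of _ 0]) (auto simp: nn)
  have mult: "u (q * k + r) \<le> real q * u k + u r" for q k r
  proof (induction q)
    case (Suc q)
    have "u (k + (q * k + r)) \<le> u k + (real q * u k + u r)"
      using sub[of k "q * k + r"] Suc by simp
    then show ?case by (simp add: algebra_simps)
  qed simp
  have "(\<lambda>n. u n / real n) \<longlonglongrightarrow> L"
  proof (rule order_tendstoI)
    fix a assume "a < L"
    have "a < u n / real n" if "1 \<le> n" for n
      using \<open>a < L\<close> cINF_lower[OF bdd, of n] that by (auto simp: L_def)
    then show "\<forall>\<^sub>F n in sequentially. a < u n / real n"
      by (auto simp: eventually_sequentially intro!: exI[of _ 1])
  next
    fix a assume "L < a"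
    then obtain k where k: "1 \<le> k" "u k / real k < a"
      using cINF_less_iff[OF _ bdd, of a] by (auto simp: L_def)
    \<comment> \<open>As all terms are nonnegative, this one sum dominates every possible remainder
      term \<open>u (n mod k)\<close>.\<close>
    define C where "C = (\<Sum>r<k. u r)"
    have bound: "u n / real n \<le> u k / real k + C / real n" if n: "1 \<le> n" for n
    proof -
      have "u n \<le> real (n div k) * u k + u (n mod k)"
        using mult[of "n div k" k "n mod k"] by simp
      moreover have "u (n mod k) \<le> C"
        unfolding C_def using k by (intro member_le_sum) (auto simp: nn)
      moreover have "real (n div k) * u k \<le> (real n / real k) * u k"
        by (intro mult_right_mono nn of_nat_div_le_of_nat)
      ultimately have "u n \<le> real n * (u k / real k) + C"
        by simp
      then show ?thesis
        using n by (simp add: field_simps)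
    qed
    have "(\<lambda>n. u k / real k + C / real n) \<longlonglongrightarrow> u k / real k + 0"
      by (intro tendsto_intros lim_const_over_n)
    then have "\<forall>\<^sub>F n in sequentially. u k / real k + C / real n < a"
      using k by (intro order_tendstoD) auto
    then show "\<forall>\<^sub>F n in sequentially. u n / real n < a"
      using eventually_ge_at_top[of 1]
      by eventually_elim (use bound in force)
  qed
  then show ?thesis
    by (rule convergentI)
qed

section \<open>Entropy of finitely valued random variables\<close>

text \<open>Shannon entropy of the law of \<open>X\<close>. Values of probability zero contribute
  \<open>0 * ln 0 = 0\<close>, as usual.\<close>

definition rv_entropy :: "'a measure \<Rightarrow> ('a \<Rightarrow> 'b) \<Rightarrow> 'b set \<Rightarrow> real" where
  "rv_entropy M X I = (\<Sum>a\<in>I. - measure M (X -` {a} \<inter> space M) * ln (measure M (X -` {a} \<inter> space M)))"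

lemma measurable_map_upt:
  assumes f: "\<And>i. f i \<in> measurable M (count_space S)" and S: "finite S"
  shows "(\<lambda>x. map (\<lambda>i. f i x) [0..<n]) \<in> measurable M (count_space (words S n))"
  unfolding measurable_count_space_eq2[OF finite_words[OF S]]
proof (intro conjI ballI)
  show "(\<lambda>x. map (\<lambda>i. f i x) [0..<n]) \<in> space M \<rightarrow> words S n"
    using measurable_space[OF f] by (auto simp: words_def)
next
  fix w assume w: "w \<in> words S n"
  have "{x \<in> space M. \<forall>i\<in>{..<n}. f i x = w ! i} \<in> sets M"
  proof (rule sets.sets_Collect_finite_All)
    fix i assume "i \<in> {..<n}"
    then have "f i -` {w ! i} \<inter> space M \<in> sets M"
      using nth_words[OF w] by (intro measurable_sets[OF f]) auto
    then show "{x \<in> space M. f i x = w ! i} \<in> sets M"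
      by (simp add: vimage_def Int_def conj_commute)
  qed simp
  also have "{x \<in> space M. \<forall>i\<in>{..<n}. f i x = w ! i} = (\<lambda>x. map (\<lambda>i. f i x) [0..<n]) -` {w} \<inter> space M"
  proof -
    have "map (\<lambda>i. f i x) [0..<n] = w \<longleftrightarrow> (\<forall>i\<in>{..<n}. f i x = w ! i)" for x
      unfolding list_eq_iff_nth_eq[of _ w] using length_words[OF w] by (simp add: Ball_def)
    then show ?thesis by blast
  qed
  finally show "(\<lambda>x. map (\<lambda>i. f i x) [0..<n]) -` {w} \<inter> space M \<in> sets M" .
qed

lemma measurable_Pair_count_space:
  assumes X: "X \<in> measurable M (count_space I)" and Y: "Y \<in> measurable M (count_space K)"
    and fin: "finite I" "finite K"
  shows "(\<lambda>x. (X x, Y x)) \<in> measurable M (count_space (I \<times> K))"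
  unfolding measurable_count_space_eq2[OF finite_cartesian_product[OF fin]]
proof (intro conjI ballI)
  show "(\<lambda>x. (X x, Y x)) \<in> space M \<rightarrow> I \<times> K"
    using measurable_space[OF X] measurable_space[OF Y] by auto
next
  fix z assume z: "z \<in> I \<times> K"
  have "(\<lambda>x. (X x, Y x)) -` {z} \<inter> space M = (X -` {fst z} \<inter> space M) \<inter> (Y -` {snd z} \<inter> space M)"
    by auto
  also have "\<dots> \<in> sets M"
    using z by (intro sets.Int measurable_sets[OF X] measurable_sets[OF Y]) auto
  finally show "(\<lambda>x. (X x, Y x)) -` {z} \<inter> space M \<in> sets M" .
qed

context prob_space
begin

text \<open>On the space, \<open>g (X x)\<close> is a finite combination of indicators of fibres of
  \<open>X\<close>. Hence \<open>g\<close> may be an arbitrary function.\<close>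

lemma
  fixes g :: "'b \<Rightarrow> real"
  assumes X: "X \<in> measurable M (count_space I)" and I: "finite I"
  shows integrable_finite_valued: "integrable M (\<lambda>x. g (X x))"
    and integral_finite_valued: "(\<integral>x. g (X x) \<partial>M) = (\<Sum>a\<in>I. prob (X -` {a} \<inter> space M) * g a)"
proof -
  have ev: "X -` {a} \<inter> space M \<in> sets M" if "a \<in> I" for a
    using measurable_sets[OF X, of "{a}"] that by simp
  have eq: "g (X x) = (\<Sum>a\<in>I. indicator (X -` {a} \<inter> space M) x * g a)" if "x \<in> space M" for x
  proof -
    have "(\<Sum>a\<in>I. indicator (X -` {a} \<inter> space M) x * g a) = (\<Sum>a\<in>I. if a = X x then g a else 0)"
      using that by (intro sum.cong refl) (auto simp: indicator_def)
    then show ?thesis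
      using I measurable_space[OF X that] by simp
  qed
  have int: "integrable M (\<lambda>x. indicator (X -` {a} \<inter> space M) x * g a)" if "a \<in> I" for a
    using ev[OF that] by (intro integrable_mult_left) (simp add: integrable_indicator_iff less_top[symmetric])
  have "integrable M (\<lambda>x. \<Sum>a\<in>I. indicator (X -` {a} \<inter> space M) x * g a)"
    by (intro Bochner_Integration.integrable_sum int)
  then show "integrable M (\<lambda>x. g (X x))"
    by (subst Bochner_Integration.integrable_cong[OF refl eq])
  have "(\<integral>x. g (X x) \<partial>M) = (\<integral>x. (\<Sum>a\<in>I. indicator (X -` {a} \<inter> space M) x * g a) \<partial>M)"
    by (intro Bochner_Integration.integral_cong refl eq)
  also have "\<dots> = (\<Sum>a\<in>I. \<integral>x. indicator (X -` {a} \<inter> space M) x * g a \<partial>M)"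
    by (rule Bochner_Integration.integral_sum[OF int])
  also have "\<dots> = (\<Sum>a\<in>I. prob (X -` {a} \<inter> space M) * g a)"
    using ev by (intro sum.cong refl) (simp add: Int_absorb1 sets.sets_into_space)
  finally show "(\<integral>x. g (X x) \<partial>M) = (\<Sum>a\<in>I. prob (X -` {a} \<inter> space M) * g a)" .
qed

lemma sum_prob_finite_valued:
  assumes "X \<in> measurable M (count_space I)" and "finite I"
  shows "(\<Sum>a\<in>I. prob (X -` {a} \<inter> space M)) = 1"
  using integral_finite_valued[OF assms, of "\<lambda>_. 1"] by (simp add: prob_space)

text \<open>Gibbs' inequality for the law of \<open>X\<close> against a trial sub-probability
  \<open>R\<close>. Each entropy estimate from above below is obtained from this by a suitable
  choice of \<open>R\<close>.\<close>

lemma rv_entropy_le_integral: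
  fixes R :: "'b \<Rightarrow> real"
  assumes X: "X \<in> measurable M (count_space I)" and I: "finite I"
    and R: "\<And>a. a \<in> I \<Longrightarrow> 0 \<le> R a" "sum R I \<le> 1" and pos: "AE x in M. 0 < R (X x)"
  shows "rv_entropy M X I \<le> (\<integral>x. - ln (R (X x)) \<partial>M)"
proof -
  \<comment> \<open>If \<open>R\<close> vanished at a value of positive probability, it would vanish
    along \<open>X\<close> on a set of positive measure.\<close>
  have "0 < R a" if a: "a \<in> I" "0 < prob (X -` {a} \<inter> space M)" for a
  proof (rule ccontr)
    assume "\<not> 0 < R a"
    with pos have "AE x in M. x \<notin> X -` {a} \<inter> space M"
      by (auto elim!: eventually_mono)
    then have "prob (X -` {a} \<inter> space M) = 0"
      using measurable_sets[OF X, of "{a}"] a by (subst prob_eq_0) auto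
    with a show False by simp
  qed
  then have "(\<Sum>a\<in>I. prob (X -` {a} \<inter> space M) * ln (R a))
      \<le> (\<Sum>a\<in>I. prob (X -` {a} \<inter> space M) * ln (prob (X -` {a} \<inter> space M)))"
    using R sum_prob_finite_valued[OF X I] by (intro gibbs_inequality) auto
  then show ?thesis
    using integral_finite_valued[OF X I, of "\<lambda>a. - ln (R a)"]
    by (simp add: rv_entropy_def sum_negf del: Bochner_Integration.integral_minus)
qed

lemma rv_entropy_nonneg: "0 \<le> rv_entropy M X I"
proof -
  have "p * ln p \<le> 0" if "0 \<le> p" "p \<le> 1" for p :: real
    using that by (cases "p = 0") (auto simp: mult_le_0_iff)
  then show ?thesis
    unfolding rv_entropy_def by (intro sum_nonneg) simp
qed

text \<open>There are finitely many fibres, so those of measure zero have a null union. This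
  supplies the positivity with which the logarithm of a product of probabilities can be
  split.\<close>

lemma AE_prob_fibre_pos:
  assumes X: "X \<in> measurable M (count_space I)" and I: "finite I"
  shows "AE x in M. 0 < prob (X -` {X x} \<inter> space M)"
proof -
  have "AE x in M. X x = a \<longrightarrow> 0 < prob (X -` {a} \<inter> space M)" if "a \<in> I" for a
  proof (cases "prob (X -` {a} \<inter> space M) = 0")
    case True
    then have "AE x in M. x \<notin> X -` {a} \<inter> space M"
      using measurable_sets[OF X, of "{a}"] that by (subst (asm) prob_eq_0) auto
    then show ?thesis
      using AE_space by eventually_elim auto
  qed (simp add: less_le)
  then have "AE x in M. \<forall>a\<in>I. X x = a \<longrightarrow> 0 < prob (X -` {a} \<inter> space M)"
    using I by (subst AE_ball_countable) (auto intro: countable_finite)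
  then show ?thesis
    using AE_space by eventually_elim (use measurable_space[OF X] in auto)
qed

text \<open>A fibre of \<open>X\<close> is the disjoint union of fibres of the pair, and each of
  these is less probable, so it has the larger \<open>- ln\<close>.\<close>

lemma rv_entropy_Pair_ge:
  assumes X: "X \<in> measurable M (count_space I)" and Y: "Y \<in> measurable M (count_space K)"
    and fin: "finite I" "finite K"
  shows "rv_entropy M X I \<le> rv_entropy M (\<lambda>x. (X x, Y x)) (I \<times> K)"
proof -
  let ?p = "\<lambda>a. prob (X -` {a} \<inter> space M)"
  let ?q = "\<lambda>a c. prob ((\<lambda>x. (X x, Y x)) -` {(a, c)} \<inter> space M)"
  have ev: "X -` {a} \<inter> space M \<in> sets M" "Y -` {c} \<inter> space M \<in> sets M" if "a \<in> I" "c \<in> K" for a c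
    using measurable_sets[OF X, of "{a}"] measurable_sets[OF Y, of "{c}"] that by auto
  have q_eq: "(\<lambda>x. (X x, Y x)) -` {(a, c)} \<inter> space M = (X -` {a} \<inter> space M) \<inter> (Y -` {c} \<inter> space M)" for a c
    by auto
  have "- ?p a * ln (?p a) \<le> (\<Sum>c\<in>K. - ?q a c * ln (?q a c))" if a: "a \<in> I" for a
  proof -
    have "?p a = prob (\<Union>c\<in>K. (\<lambda>x. (X x, Y x)) -` {(a, c)} \<inter> space M)"
      using measurable_space[OF Y] by (intro arg_cong[where f = prob]) auto
    also have "\<dots> = (\<Sum>c\<in>K. ?q a c)"
      using ev a fin unfolding q_eq
      by (intro finite_measure_finite_Union) (auto simp: disjoint_family_on_def)
    finally have "- ?p a * ln (?p a) = (\<Sum>c\<in>K. - ?q a c * ln (?p a))"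
      by (simp add: sum_distrib_right sum_negf)
    also have "\<dots> \<le> (\<Sum>c\<in>K. - ?q a c * ln (?q a c))"
    proof (intro sum_mono)
      fix c assume "c \<in> K"
      then have "?q a c \<le> ?p a"
        using ev a unfolding q_eq by (intro finite_measure_mono) auto
      then show "- ?q a c * ln (?p a) \<le> - ?q a c * ln (?q a c)"
        using measure_nonneg[of M "(\<lambda>x. (X x, Y x)) -` {(a, c)} \<inter> space M"]
        by (cases "?q a c = 0") (auto simp: less_le intro!: mult_left_mono ln_mono)
    qed
    finally show ?thesis .
  qed
  then show ?thesis
    unfolding rv_entropy_def sum.cartesian_product' by (rule sum_mono)
qed

end

section \<open>Entropy of a partition along a measure-preserving map\<close>

definition atom :: "'a set set \<Rightarrow> 'a \<Rightarrow> 'a set" where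
  "atom Q x = (THE S. S \<in> Q \<and> x \<in> S)"

definition itinerary :: "('a \<Rightarrow> 'a) \<Rightarrow> 'a set set \<Rightarrow> nat \<Rightarrow> 'a \<Rightarrow> 'a set list" where
  "itinerary T Q n x = map (\<lambda>i. atom Q ((T ^^ i) x)) [0..<n]"

lemma itinerary_add: "itinerary T Q (m + n) x = itinerary T Q m x @ itinerary T Q n ((T ^^ m) x)"
proof -
  have "[0..<m + n] = [0..<m] @ map (\<lambda>i. i + m) [0..<n]"
    by (simp only: map_add_upt upt_add_eq_append[of 0 m n] add.commute)
  then show ?thesis
    by (simp add: itinerary_def funpow_add comp_def)
qed

locale partition_of =
  fixes M :: "'a measure" and Q :: "'a set set"
  assumes partition: "Q \<in> finite_measurable_partitions M"
begin

lemma finite_Q: "finite Q" and sets_Q: "S \<in> Q \<Longrightarrow> S \<in> sets M" and Union_Q: "\<Union>Q = space M"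
  and disjoint_Q: "disjoint Q"
  using partition by (auto simp: finite_measurable_partitions_def)

lemma atom_eqI: "S \<in> Q \<Longrightarrow> x \<in> S \<Longrightarrow> atom Q x = S"
  unfolding atom_def using disjoint_Q by (intro the_equality) (auto simp: disjoint_def)

lemma atom: "x \<in> space M \<Longrightarrow> atom Q x \<in> Q \<and> x \<in> atom Q x"
  using atom_eqI Union_Q by (metis UnionE)

lemma atom_eq_iff: "x \<in> space M \<Longrightarrow> S \<in> Q \<Longrightarrow> atom Q x = S \<longleftrightarrow> x \<in> S"
  using atom atom_eqI by metis

lemma measurable_atom: "atom Q \<in> measurable M (count_space Q)"
  unfolding measurable_count_space_eq2[OF finite_Q]
proof (intro conjI ballI)
  fix S assume S: "S \<in> Q"
  have "atom Q -` {S} \<inter> space M = S"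
  proof (rule set_eqI)
    fix x
    have "x \<in> S \<Longrightarrow> x \<in> space M"
      using Union_Q S by blast
    then show "x \<in> atom Q -` {S} \<inter> space M \<longleftrightarrow> x \<in> S"
      using atom_eq_iff[OF _ S, of x] by blast
  qed
  then show "atom Q -` {S} \<inter> space M \<in> sets M"
    using sets_Q[OF S] by simp
qed (use atom in blast)

end

locale measure_preserving = prob_space M for M :: "'a measure" and T :: "'a \<Rightarrow> 'a" +
  assumes measurable_T: "T \<in> measurable M M" and distr_T: "distr M M T = M"
begin

lemma measurable_iterate: "T ^^ i \<in> measurable M M"
  by (rule measurable_compose_n[OF measurable_T])

lemma distr_iterate: "distr M M (T ^^ i) = M"
proof (induction i)
  case 0
  then show ?case by (simp add: id_def distr_id)
next
  case (Suc i)
  then show ?case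
    using distr_distr[OF measurable_T measurable_iterate[of i]] distr_T by (simp add: comp_def)
qed

lemma integral_iterate:
  fixes f :: "'a \<Rightarrow> real"
  assumes "f \<in> borel_measurable M"
  shows "(\<integral>x. f ((T ^^ i) x) \<partial>M) = (\<integral>x. f x \<partial>M)"
  using integral_distr[OF measurable_iterate assms, of i] by (simp add: distr_iterate)

lemma integrable_iterate:
  fixes f :: "'a \<Rightarrow> real"
  assumes "integrable M f"
  shows "integrable M (\<lambda>x. f ((T ^^ i) x))"
  using assms distr_iterate[of i] by (metis integrable_distr measurable_iterate)

lemma AE_iterate:
  assumes "AE x in M. P x"
  shows "AE x in M. P ((T ^^ i) x)"
  using AE_distrD[OF measurable_iterate[of i], of P] assms by (simp only: distr_iterate)

end

locale preserved_partition = measure_preserving M T + partition_of M Q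
  for M :: "'a measure" and T Q
begin

lemma itinerary_fibre:
  assumes w: "w \<in> words Q n"
  shows "itinerary T Q n -` {w} \<inter> space M = space M \<inter> (\<Inter>i<n. (T ^^ i) -` (w ! i))"
proof -
  have "itinerary T Q n x = w \<longleftrightarrow> (\<forall>i<n. (T ^^ i) x \<in> w ! i)" if "x \<in> space M" for x
    using w nth_words[OF w] atom_eq_iff[OF measurable_space[OF measurable_iterate that]]
    by (auto simp: list_eq_iff_nth_eq itinerary_def length_words)
  then show ?thesis
    by auto
qed

lemma measurable_itinerary: "itinerary T Q n \<in> measurable M (count_space (words Q n))"
  unfolding itinerary_def
  by (intro measurable_map_upt measurable_compose[OF measurable_iterate measurable_atom] finite_Q)

text \<open>The join is a set of sets, whereas the itinerary is indexed by words. Two different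
  words can define the same set only if it is empty, and the empty set contributes \<open>0\<close>,
  so both sums agree.\<close>

lemma partition_entropy_iterated_join:
  "partition_entropy M (iterated_join M T Q n) = rv_entropy M (itinerary T Q n) (words Q n)"
proof -
  let ?S = "\<lambda>w. space M \<inter> (\<Inter>i<n. (T ^^ i) -` (w ! i))"
  have "iterated_join M T Q n = ?S ` words Q n"
  proof (safe, goal_cases)
    case (1 S)
    then obtain f where f: "S = space M \<inter> (\<Inter>i<n. (T ^^ i) -` f i)" "\<forall>i<n. f i \<in> Q"
      by (auto simp: iterated_join_def)
    then have "S = ?S (map f [0..<n])" "map f [0..<n] \<in> words Q n"
      by (auto simp: words_def)
    then show ?case by blast
  next
    case (2 S w)
    then show ?case
      unfolding iterated_join_def by (auto intro!: exI[of _ "\<lambda>i. w ! i"] nth_words)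
  qed
  then have "partition_entropy M (iterated_join M T Q n)
      = (\<Sum>w\<in>words Q n. - prob (?S w) * ln (prob (?S w)))"
    unfolding partition_entropy_def
  proof (simp only:, subst sum.reindex_nontrivial)
    fix u v assume uv: "u \<in> words Q n" "v \<in> words Q n" "u \<noteq> v" "?S u = ?S v"
    then have "?S u = {}"
      using itinerary_fibre[of u n] itinerary_fibre[of v n] by auto
    then show "- prob (?S u) * ln (prob (?S u)) = 0"
      by simp
  qed (simp_all add: finite_Q)
  then show ?thesis
    by (simp add: rv_entropy_def itinerary_fibre)
qed

text \<open>The trial law makes the first \<open>m\<close> and the last \<open>n\<close> cells
  independent with their true laws. By invariance the law of the last \<open>n\<close> cells is that
  of the itinerary of length \<open>n\<close>, so the bound is the sum of the two entropies.\<close>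

lemma rv_entropy_itinerary_subadditive:
  "rv_entropy M (itinerary T Q (m + n)) (words Q (m + n))
    \<le> rv_entropy M (itinerary T Q m) (words Q m) + rv_entropy M (itinerary T Q n) (words Q n)"
proof -
  define p where "p k w = prob (itinerary T Q k -` {w} \<inter> space M)" for k w
  have sum_p: "(\<Sum>w\<in>words Q k. p k w) = 1" for k
    unfolding p_def by (intro sum_prob_finite_valued measurable_itinerary) (simp add: finite_Q)
  have int: "integrable M (\<lambda>x. - ln (p k (itinerary T Q k x)))" for k
    by (rule integrable_finite_valued[OF measurable_itinerary]) (simp add: finite_Q)
  have ent: "(\<integral>x. - ln (p k (itinerary T Q k x)) \<partial>M) = rv_entropy M (itinerary T Q k) (words Q k)" for k
    by (subst integral_finite_valued[OF measurable_itinerary]) (simp_all add: finite_Q rv_entropy_def p_def)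
  define R where "R w = p m (take m w) * p n (drop m w)" for w
  have "AE x in M. 0 < p k (itinerary T Q k x)" for k
    unfolding p_def by (rule AE_prob_fibre_pos[OF measurable_itinerary]) (simp add: finite_Q)
  then have "AE x in M. 0 < p m (itinerary T Q m x)" "AE x in M. 0 < p n (itinerary T Q n ((T ^^ m) x))"
    by (auto intro: AE_iterate)
  then have pos: "AE x in M. 0 < p m (itinerary T Q m x) \<and> 0 < p n (itinerary T Q n ((T ^^ m) x))"
    by simp
  have R_eq: "R (itinerary T Q (m + n) x) = p m (itinerary T Q m x) * p n (itinerary T Q n ((T ^^ m) x))" for x
    by (simp add: R_def itinerary_add) (simp add: itinerary_def)
  have "rv_entropy M (itinerary T Q (m + n)) (words Q (m + n)) \<le> (\<integral>x. - ln (R (itinerary T Q (m + n) x)) \<partial>M)"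
  proof (rule rv_entropy_le_integral[OF measurable_itinerary])
    have "sum R (words Q (m + n)) = (\<Sum>u\<in>words Q m. \<Sum>v\<in>words Q n. p m u * p n v)"
      unfolding sum_words_append by (intro sum.cong refl) (simp add: R_def length_words)
    then show "sum R (words Q (m + n)) \<le> 1"
      by (simp add: sum_product[symmetric] sum_p)
    show "AE x in M. 0 < R (itinerary T Q (m + n) x)"
      using pos by eventually_elim (simp add: R_eq)
  qed (auto simp: finite_Q R_def p_def)
  also have "\<dots> = (\<integral>x. - ln (p m (itinerary T Q m x)) + - ln (p n (itinerary T Q n ((T ^^ m) x))) \<partial>M)"
  proof (rule integral_cong_AE)
    show "(\<lambda>x. - ln (R (itinerary T Q (m + n) x))) \<in> borel_measurable M"
      by (rule borel_measurable_integrable, rule integrable_finite_valued[OF measurable_itinerary])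
        (simp add: finite_Q)
    show "(\<lambda>x. - ln (p m (itinerary T Q m x)) + - ln (p n (itinerary T Q n ((T ^^ m) x)))) \<in> borel_measurable M"
      by (intro borel_measurable_integrable Bochner_Integration.integrable_add int integrable_iterate)
    show "AE x in M. - ln (R (itinerary T Q (m + n) x)) =
        - ln (p m (itinerary T Q m x)) + - ln (p n (itinerary T Q n ((T ^^ m) x)))"
      using pos by eventually_elim (simp add: R_eq ln_mult)
  qed
  also have "\<dots> = (\<integral>x. - ln (p m (itinerary T Q m x)) \<partial>M) + (\<integral>x. - ln (p n (itinerary T Q n ((T ^^ m) x))) \<partial>M)"
    by (intro Bochner_Integration.integral_add int integrable_iterate)
  also have "\<dots> = rv_entropy M (itinerary T Q m) (words Q m) + rv_entropy M (itinerary T Q n) (words Q n)"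
    using integral_iterate[OF borel_measurable_integrable[OF int[of n]]] ent by simp
  finally show ?thesis .
qed

text \<open>The \<open>lim\<close> in \<open>ks_entropy\<close> has a definite meaning only for a
  convergent sequence; Fekete's lemma shows that the sequence does converge.\<close>

lemma LIMSEQ_partition_entropy:
  "(\<lambda>n. partition_entropy M (iterated_join M T Q n) / real n)
    \<longlonglongrightarrow> lim (\<lambda>n. partition_entropy M (iterated_join M T Q n) / real n)"
  unfolding convergent_LIMSEQ_iff[symmetric] partition_entropy_iterated_join
  by (rule fekete_convergent[OF rv_entropy_nonneg rv_entropy_itinerary_subadditive])

end

section \<open>Cylinder approximation on the full shift\<close>

definition prefix_word :: "nat \<Rightarrow> (nat \<Rightarrow> 'a) \<Rightarrow> 'a list" where
  "prefix_word n x = map x [0..<n]"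

lemma length_prefix_word [simp]: "length (prefix_word n x) = n"
  by (simp add: prefix_word_def)

lemma nth_prefix_word [simp]: "i < n \<Longrightarrow> prefix_word n x ! i = x i"
  by (simp add: prefix_word_def)

lemma take_prefix_word: "k \<le> n \<Longrightarrow> take k (prefix_word n x) = prefix_word k x"
  by (simp add: prefix_word_def take_map)

lemma funpow_shift: "(shift ^^ i) x = (\<lambda>n. x (n + i))"
  by (induction i arbitrary: x) (simp_all add: shift_def)

lemma window_prefix_word:
  assumes "i + k \<le> n"
  shows "take k (drop i (prefix_word n x)) = prefix_word k ((shift ^^ i) x)"
  using assms by (auto simp: list_eq_iff_nth_eq funpow_shift add.commute)

lemma prefix_word_eq_iff: "length w = n \<Longrightarrow> prefix_word n x = w \<longleftrightarrow> (\<forall>i<n. x i = w ! i)"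
  by (auto simp: list_eq_iff_nth_eq)

locale full_shift_prob = prob_space \<nu> for \<nu> :: "(nat \<Rightarrow> nat) measure" +
  fixes N :: nat
  assumes sets_nu: "sets \<nu> = sets (full_shift_measure N)"
begin

lemma space_nu: "space \<nu> = {x. \<forall>i. x i \<in> {1..N}}"
  using sets_eq_imp_space_eq[OF sets_nu] by (auto simp: full_shift_measure_def space_PiM PiE_iff)

lemma measurable_coordinate: "(\<lambda>x. x i) \<in> measurable \<nu> (count_space {1..N})"
  unfolding measurable_cong_sets[OF sets_nu refl] full_shift_measure_def
  by (rule measurable_component_singleton) simp

lemma measurable_prefix_word: "prefix_word n \<in> measurable \<nu> (count_space (words {1..N} n))"
  unfolding prefix_word_def by (intro measurable_map_upt measurable_coordinate) simp

lemma prefix_event: "{x \<in> space \<nu>. prefix_word n x \<in> D} \<in> sets \<nu>"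
proof -
  have "{x \<in> space \<nu>. prefix_word n x \<in> D} = prefix_word n -` (D \<inter> words {1..N} n) \<inter> space \<nu>"
    using measurable_space[OF measurable_prefix_word] by auto
  also have "\<dots> \<in> sets \<nu>"
    by (rule measurable_sets[OF measurable_prefix_word]) simp
  finally show ?thesis .
qed

lemma sets_nu_generated:
  "sets \<nu> = sigma_sets (space \<nu>) {{x \<in> space \<nu>. x i \<in> A} | i A. A \<subseteq> {1..N}}"
proof -
  have "sets \<nu> = sigma_sets (\<Pi>\<^sub>E i\<in>UNIV. {1..N}) {{f \<in> \<Pi>\<^sub>E i\<in>UNIV. {1..N}. f i \<in> A} | i A. A \<subseteq> {1..N}}"
    unfolding sets_nu full_shift_measure_def sets_PiM_single by simp
  moreover have "(\<Pi>\<^sub>E i\<in>UNIV. {1..N}) = space \<nu>"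
    by (auto simp: space_nu)
  ultimately show ?thesis
    by simp
qed

text \<open>Induction over the generated sigma algebra: events that are determined by finitely many
  letters up to arbitrarily small measure include the generators and are closed under complements
  and countable unions.\<close>

lemma cylinder_approximation:
  assumes E: "E \<in> sets \<nu>" and e: "0 < e"
  shows "\<exists>k D. prob (sym_diff E {x \<in> space \<nu>. prefix_word k x \<in> D}) < e"
proof -
  have "E \<in> sigma_sets (space \<nu>) {{x \<in> space \<nu>. x i \<in> A} | i A. A \<subseteq> {1..N}}"
    using E sets_nu_generated by simp
  then show ?thesis
    using e
  proof (induction arbitrary: e)
    case (Basic a)
    then obtain i A where a: "a = {x \<in> space \<nu>. x i \<in> A}"
      by auto
    have "a = {x \<in> space \<nu>. prefix_word (Suc i) x \<in> {w. w ! i \<in> A}}"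
      by (simp add: a)
    then show ?case
      using Basic.prems by (intro exI[of _ "Suc i"] exI[of _ "{w. w ! i \<in> A}"]) simp
  next
    case Empty
    then show ?case
      by (intro exI[of _ 0] exI[of _ "{}"]) simp
  next
    case (Compl a)
    then obtain k D where kD: "prob (sym_diff a {x \<in> space \<nu>. prefix_word k x \<in> D}) < e"
      by blast
    have "a \<subseteq> space \<nu>"
      using Compl.hyps sets_nu_generated sets.sets_into_space by blast
    then have eq: "sym_diff (space \<nu> - a) {x \<in> space \<nu>. prefix_word k x \<in> - D}
        = sym_diff a {x \<in> space \<nu>. prefix_word k x \<in> D}"
      by auto
    show ?case
      by (intro exI[of _ k] exI[of _ "- D"]) (simp only: eq kD)
  next
    case (Union a)
    have a: "a i \<in> sets \<nu>" for i
      using Union.hyps sets_nu_generated by blast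
    \<comment> \<open>Continuity from below cuts the countable union down to a finite one at the
      cost of \<open>e / 2\<close>.\<close>
    have "(\<lambda>n. prob (\<Union>i\<le>n. a i)) \<longlonglongrightarrow> prob (\<Union>n. \<Union>i\<le>n. a i)"
    proof (rule finite_Lim_measure_incseq)
      show "range (\<lambda>n. \<Union>i\<le>n. a i) \<subseteq> events"
        using a by blast
      show "incseq (\<lambda>n. \<Union>i\<le>n. a i)"
        by (intro monoI UN_mono) auto
    qed
    also have "(\<Union>n. \<Union>i\<le>n. a i) = (\<Union>i. a i)"
      by auto
    finally have "\<forall>\<^sub>F n in sequentially. prob (\<Union>i. a i) - e / 2 < prob (\<Union>i\<le>n. a i)"
      using Union.prems by (intro order_tendstoD) auto
    then obtain n where n: "prob (\<Union>i. a i) - e / 2 < prob (\<Union>i\<le>n. a i)"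
      by (auto simp: eventually_sequentially)
    \<comment> \<open>The remaining \<open>e / 2\<close> is divided among the \<open>Suc n\<close>
      sets of the finite union.\<close>
    define d where "d = e / (2 * real (Suc n))"
    have "0 < d"
      using Union.prems by (simp add: d_def)
    define near where "near i k D \<longleftrightarrow> prob (sym_diff (a i) {x \<in> space \<nu>. prefix_word k x \<in> D}) < d" for i k D
    have "\<exists>k D. near i k D" for i
      unfolding near_def using Union.IH \<open>0 < d\<close> by blast
    then obtain k D where "near i (k i) (D i)" for i
      by metis
    then have kD: "prob (sym_diff (a i) {x \<in> space \<nu>. prefix_word (k i) x \<in> D i}) < d" for i
      by (simp only: near_def)
    \<comment> \<open>A common prefix length: every \<open>k i\<close> with \<open>i \<le> n\<close>
      is at most \<open>K\<close>, so a single word of length \<open>K\<close> decides all the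
      approximating events.\<close>
    define K where "K = (\<Sum>i\<le>n. k i)"
    have k_le: "k i \<le> K" if "i \<le> n" for i
      unfolding K_def using that by (intro member_le_sum) auto
    define F where "F = {w. \<exists>i\<le>n. take (k i) w \<in> D i}"
    let ?C = "\<lambda>i. {x \<in> space \<nu>. prefix_word (k i) x \<in> D i}"
    have F_eq: "{x \<in> space \<nu>. prefix_word K x \<in> F} = (\<Union>i\<le>n. ?C i)"
      unfolding F_def using k_le by (auto simp: take_prefix_word)
    have C: "?C i \<in> sets \<nu>" for i
      by (rule prefix_event)
    have "prob (sym_diff (\<Union>i. a i) {x \<in> space \<nu>. prefix_word K x \<in> F})
        \<le> prob (((\<Union>i. a i) - (\<Union>i\<le>n. a i)) \<union> (\<Union>i\<le>n. sym_diff (a i) (?C i)))"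
      unfolding F_eq using a C by (intro finite_measure_mono) auto
    also have "\<dots> \<le> prob ((\<Union>i. a i) - (\<Union>i\<le>n. a i)) + prob (\<Union>i\<le>n. sym_diff (a i) (?C i))"
      using a C by (intro measure_Un_le) auto
    also have "prob (\<Union>i\<le>n. sym_diff (a i) (?C i)) \<le> (\<Sum>i\<le>n. prob (sym_diff (a i) (?C i)))"
      using a C by (intro measure_UNION_le) auto
    also have "\<dots> \<le> (\<Sum>i\<le>n. d)"
      using kD by (intro sum_mono less_imp_le) auto
    also have "\<dots> = e / 2"
      by (simp add: d_def del: of_nat_Suc)
    also have "prob ((\<Union>i. a i) - (\<Union>i\<le>n. a i)) = prob (\<Union>i. a i) - prob (\<Union>i\<le>n. a i)"
      using a by (intro finite_measure_Diff) auto
    finally show ?case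
      using n by (intro exI[of _ K] exI[of _ F]) linarith
  qed
qed

text \<open>Every cell is approximated by an event in the letters, and \<open>g\<close> picks a cell
  whose approximating event occurs. The guess can be wrong only on the union of the symmetric
  differences.\<close>

lemma partition_approximation:
  assumes "partition_of \<nu> Q" and e: "0 < e"
  shows "\<exists>k g. prob {x \<in> space \<nu>. g (prefix_word k x) \<noteq> atom Q x} < e"
proof -
  interpret partition_of \<nu> Q by fact
  \<comment> \<open>With \<open>Suc (card Q)\<close> in the denominator, the errors of the
    \<open>card Q\<close> cells add up to strictly less than \<open>e\<close>.\<close>
  define d where "d = e / real (Suc (card Q))"
  have "0 < d"
    using e by (simp add: d_def)
  define near where "near S k D \<longleftrightarrow> prob (sym_diff S {x \<in> space \<nu>. prefix_word k x \<in> D}) < d" for S k D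
  have "\<exists>k D. near S k D" if "S \<in> Q" for S
    unfolding near_def using sets_Q[OF that] \<open>0 < d\<close> by (rule cylinder_approximation)
  then obtain k D where "\<And>S. S \<in> Q \<Longrightarrow> near S (k S) (D S)"
    by metis
  then have kD: "\<And>S. S \<in> Q \<Longrightarrow> prob (sym_diff S {x \<in> space \<nu>. prefix_word (k S) x \<in> D S}) < d"
    by (simp only: near_def)
  define K where "K = (\<Sum>S\<in>Q. k S)"
  have k_le: "k S \<le> K" if "S \<in> Q" for S
    unfolding K_def using that finite_Q by (intro member_le_sum) auto
  let ?C = "\<lambda>S. {x \<in> space \<nu>. prefix_word (k S) x \<in> D S}"
  \<comment> \<open>Outside the symmetric differences exactly one cell qualifies. Elsewhere the
    choice is arbitrary, and where no cell qualifies it may even lie outside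
    \<open>Q\<close>.\<close>
  define g where "g v = (SOME S. S \<in> Q \<and> take (k S) v \<in> D S)" for v
  have g: "g (prefix_word K x) = atom Q x"
    if x: "x \<in> space \<nu>" and good: "\<And>S. S \<in> Q \<Longrightarrow> x \<notin> sym_diff S (?C S)" for x
    unfolding g_def
  proof (rule some_equality)
    show "atom Q x \<in> Q \<and> take (k (atom Q x)) (prefix_word K x) \<in> D (atom Q x)"
      using atom[OF x] good[of "atom Q x"] x by (auto simp: take_prefix_word k_le)
  next
    fix S assume "S \<in> Q \<and> take (k S) (prefix_word K x) \<in> D S"
    then have "S \<in> Q" "x \<in> ?C S"
      using x by (auto simp: take_prefix_word k_le)
    then show "S = atom Q x"
      using good[of S] atom_eqI[of S x] by auto
  qed
  have "prob {x \<in> space \<nu>. g (prefix_word K x) \<noteq> atom Q x} \<le> prob (\<Union>S\<in>Q. sym_diff S (?C S))"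
  proof (rule finite_measure_mono)
    show "{x \<in> space \<nu>. g (prefix_word K x) \<noteq> atom Q x} \<subseteq> (\<Union>S\<in>Q. sym_diff S (?C S))"
      using g by blast
    show "(\<Union>S\<in>Q. sym_diff S (?C S)) \<in> events"
      using sets_Q prefix_event finite_Q by (intro sets.finite_UN sets.Un sets.Diff) auto
  qed
  also have "\<dots> \<le> (\<Sum>S\<in>Q. prob (sym_diff S (?C S)))"
    using sets_Q prefix_event finite_Q by (intro measure_UNION_le sets.Un sets.Diff) auto
  also have "\<dots> \<le> (\<Sum>S\<in>Q. d)"
    using kD by (intro sum_mono less_imp_le) auto
  also have "\<dots> < e"
    using e by (simp add: d_def field_simps)
  finally show ?thesis
    by blast
qed

end

locale shift_invariant_prob = full_shift_prob \<nu> N + measure_preserving \<nu> shift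
  for \<nu> :: "(nat \<Rightarrow> nat) measure" and N

lemma shift_invariant_prob_iff:
  "\<nu> \<in> invariant_measures_on N Y \<longleftrightarrow> shift_invariant_prob \<nu> N \<and> emeasure \<nu> Y = 1"
  by (auto simp: invariant_measures_on_def shift_invariant_prob_def full_shift_prob_def
      full_shift_prob_axioms_def measure_preserving_def measure_preserving_axioms_def)

section \<open>The upper bound for the pressure\<close>

(* keeps the simplifier from turning the alphabet {1..N} into {Suc 0..N} *)
declare One_nat_def [simp del]

section \<open>Path weights and partition functions\<close>

definition path_weight :: "(nat \<Rightarrow> nat \<Rightarrow> real) \<Rightarrow> nat list \<Rightarrow> real" where
  "path_weight M w = (\<Prod>i<length w - 1. M (w ! i) (w ! Suc i))"

lemma path_weight_singleton [simp]: "path_weight M [a] = 1"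
  by (simp add: path_weight_def)

lemma path_weight_snoc:
  assumes "length w = Suc n"
  shows "path_weight M (w @ [a]) = path_weight M w * M (w ! n) a"
  using assms by (simp add: path_weight_def nth_append)

lemma path_weight_nonneg:
  assumes "\<And>i j. i \<in> S \<Longrightarrow> j \<in> S \<Longrightarrow> 0 \<le> M i j" and "w \<in> words S n"
  shows "0 \<le> path_weight M w"
  unfolding path_weight_def
  using assms(2) by (intro prod_nonneg ballI assms(1)) (auto simp: length_words intro!: nth_words)

lemma path_weight_prefix_word:
  "path_weight M (prefix_word (Suc n) x) = (\<Prod>i<n. M (x i) (x (Suc i)))"
  by (simp add: path_weight_def)

definition edge_matrix :: "(nat \<Rightarrow> nat \<Rightarrow> real) \<Rightarrow> (nat \<Rightarrow> nat \<Rightarrow> real) \<Rightarrow> nat \<Rightarrow> nat \<Rightarrow> real" where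
  "edge_matrix P B i j = (if B i j = 1 then P i j else 0)"

definition partition_function :: "nat \<Rightarrow> (nat \<Rightarrow> nat \<Rightarrow> real) \<Rightarrow> nat \<Rightarrow> real" where
  "partition_function N M n = (\<Sum>w\<in>words {1..N} (Suc n). path_weight M w)"

lemma partition_function_0 [simp]: "partition_function N M 0 = real N"
  by (simp add: partition_function_def sum_words_1)

lemma partition_function_Suc:
  "partition_function N M (Suc n) = (\<Sum>w\<in>words {1..N} (Suc n). path_weight M w * (\<Sum>a\<in>{1..N}. M (w ! n) a))"
  unfolding partition_function_def sum_words_Suc[of _ "{1..N}" "Suc n"] sum_distrib_left
  by (intro sum.cong refl path_weight_snoc length_words)

text \<open>Appending a letter multiplies the weight of a word by a matrix entry, and the entries of
  a row sum to at most \<open>1\<close>.\<close>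

lemma partition_function_Suc_le:
  assumes M: "\<And>i j. i \<in> {1..N} \<Longrightarrow> j \<in> {1..N} \<Longrightarrow> 0 \<le> M i j"
    and le: "\<And>i. i \<in> {1..N} \<Longrightarrow> (\<Sum>j\<in>{1..N}. M i j) \<le> 1"
  shows "partition_function N M (Suc n) \<le> partition_function N M n"
proof -
  have nn: "0 \<le> path_weight M w" if "w \<in> words {1..N} (Suc n)" for w
    using M that by (rule path_weight_nonneg)
  have "partition_function N M (Suc n) \<le> (\<Sum>w\<in>words {1..N} (Suc n). path_weight M w * 1)"
    unfolding partition_function_Suc
    by (intro sum_mono mult_left_mono le) (blast intro: nn nth_words lessI)+
  then show ?thesis
    by (simp add: partition_function_def)
qed

text \<open>The common setting of both pressures in the theorem: it is instantiated with
  \<open>B = A\<close> and with \<open>B = hole_matrix N A G\<close>.\<close>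

locale weighted_shift =
  fixes N :: nat and P B :: "nat \<Rightarrow> nat \<Rightarrow> real"
  assumes P_stoch: "row_stochastic N P"
    and P_pos: "\<And>i j. i \<in> {1..N} \<Longrightarrow> j \<in> {1..N} \<Longrightarrow> B i j = 1 \<Longrightarrow> 0 < P i j"
begin

abbreviation "Y \<equiv> shift_space N B"
abbreviation "W \<equiv> edge_matrix P B"
abbreviation "Z \<equiv> partition_function N W"
abbreviation "\<phi> \<equiv> \<lambda>x. ln (P (x 0) (x (1::nat)))"

lemma W_nonneg: "i \<in> {1..N} \<Longrightarrow> j \<in> {1..N} \<Longrightarrow> 0 \<le> W i j"
  using P_stoch by (auto simp: edge_matrix_def row_stochastic_def)

lemma W_pos_iff: "i \<in> {1..N} \<Longrightarrow> j \<in> {1..N} \<Longrightarrow> 0 < W i j \<longleftrightarrow> B i j = 1"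
  using P_pos by (auto simp: edge_matrix_def)

lemma weight_nonneg: "w \<in> words {1..N} n \<Longrightarrow> 0 \<le> path_weight W w"
  by (rule path_weight_nonneg[OF W_nonneg])

lemma sum_W_le_1: "i \<in> {1..N} \<Longrightarrow> (\<Sum>j\<in>{1..N}. W i j) \<le> 1"
proof -
  assume i: "i \<in> {1..N}"
  then have "(\<Sum>j\<in>{1..N}. W i j) \<le> (\<Sum>j\<in>{1..N}. P i j)"
    using P_stoch by (intro sum_mono) (auto simp: edge_matrix_def row_stochastic_def)
  then show ?thesis
    using P_stoch i by (simp add: row_stochastic_def)
qed

lemma Z_nonneg: "0 \<le> Z n"
  unfolding partition_function_def by (intro sum_nonneg) (rule weight_nonneg)

lemma Z_Suc_le: "Z (Suc n) \<le> Z n"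
  by (intro partition_function_Suc_le W_nonneg sum_W_le_1)

lemma Z_antimono: "antimono Z"
  by (intro decseq_SucI Z_Suc_le)

lemma prefix_word_weight_pos:
  assumes "x \<in> Y"
  shows "0 < path_weight W (prefix_word (Suc n) x)"
  unfolding path_weight_prefix_word
  using assms by (intro prod_pos) (simp add: W_pos_iff shift_space_def)

lemma Z_pos:
  assumes "x \<in> Y"
  shows "0 < Z n"
proof -
  have "prefix_word (Suc n) x \<in> words {1..N} (Suc n)"
    using assms by (auto simp: words_def prefix_word_def shift_space_def)
  then have "path_weight W (prefix_word (Suc n) x) \<le> Z n"
    unfolding partition_function_def by (intro member_le_sum) (auto intro: weight_nonneg)
  then show ?thesis
    using prefix_word_weight_pos[OF assms, of n] by linarith
qed

lemma AE_in_Y: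
  assumes "prob_space \<nu>" and "emeasure \<nu> Y = 1"
  shows "AE x in \<nu>. x \<in> Y"
proof -
  interpret prob_space \<nu> by fact
  have "Y \<in> sets \<nu>"
    using assms(2) emeasure_notin_sets[of Y \<nu>] by auto
  then show ?thesis
    using assms(2) prob_eq_1[of Y] by (simp add: emeasure_eq_measure)
qed

lemma integrable_phi:
  assumes "full_shift_prob \<nu> N"
  shows "integrable \<nu> \<phi>"
proof -
  interpret full_shift_prob \<nu> N by fact
  have "integrable \<nu> (\<lambda>x. (\<lambda>w. ln (P (w ! 0) (w ! 1))) (prefix_word 2 x))"
    by (rule integrable_finite_valued[OF measurable_prefix_word]) simp
  then show ?thesis
    by simp
qed

text \<open>Gibbs' inequality for the joint law of the itinerary of \<open>Q\<close> and the letters of the orbit,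
  against the law that draws the letters proportionally to their weight and then the itinerary
  letter by letter from the kernel \<open>\<kappa>\<close>.\<close>
lemma itinerary_entropy_le:
  assumes inv: "shift_invariant_prob \<nu> N" and Y1: "emeasure \<nu> Y = 1" and part: "partition_of \<nu> Q"
    and \<kappa>_pos: "\<And>S v. 0 < \<kappa> S v" and \<kappa>_sum: "\<And>v. (\<Sum>S\<in>Q. \<kappa> S v) \<le> 1"
  shows "rv_entropy \<nu> (itinerary shift Q n) (words Q n)
    \<le> ln (Z (n + k)) - real (n + k) * (\<integral>x. \<phi> x \<partial>\<nu>) + real n * (\<integral>x. - ln (\<kappa> (atom Q x) (prefix_word k x)) \<partial>\<nu>)"
proof -
  interpret shift_invariant_prob \<nu> N by fact
  interpret partition_of \<nu> Q by fact
  interpret preserved_partition \<nu> shift Q ..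
  define c where "c x = - ln (\<kappa> (atom Q x) (prefix_word k x))" for x
  have Y_AE: "AE x in \<nu>. x \<in> Y"
    by (rule AE_in_Y[OF _ Y1]) (rule prob_space_axioms)
  have "Y \<noteq> {}"
    using Y1 by (metis emeasure_empty zero_neq_one)
  then have Z_pos': "0 < Z m" for m
    using Z_pos by blast
  have int_c: "integrable \<nu> c"
  proof -
    have "integrable \<nu> (\<lambda>x. (\<lambda>z. - ln (\<kappa> (fst z) (snd z))) (atom Q x, prefix_word k x))"
      by (rule integrable_finite_valued[OF measurable_Pair_count_space[OF measurable_atom measurable_prefix_word]])
        (simp_all add: finite_Q)
    then show ?thesis
      by (simp add: c_def[abs_def])
  qed
  have int_phi: "integrable \<nu> \<phi>"
    by (rule integrable_phi) (rule full_shift_prob_axioms)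
  have sum_int_phi: "integrable \<nu> (\<lambda>x. \<Sum>i<n + k. \<phi> ((shift ^^ i) x))"
    by (intro Bochner_Integration.integrable_sum integrable_iterate[OF int_phi])
  have sum_int_c: "integrable \<nu> (\<lambda>x. \<Sum>i<n. c ((shift ^^ i) x))"
    by (intro Bochner_Integration.integrable_sum integrable_iterate[OF int_c])
  have int_const: "integrable \<nu> (\<lambda>x. ln (Z (n + k)))"
    by simp
  \<comment> \<open>With \<open>n + k\<close> edges there are \<open>n + k + 1\<close> letters,
    enough for a window of \<open>k\<close> letters at each of the \<open>n\<close> positions of the
    itinerary.\<close>
  let ?w = "prefix_word (Suc (n + k))"
  let ?X = "\<lambda>x. (itinerary shift Q n x, ?w x)"
  let ?I = "words Q n \<times> words {1..N} (Suc (n + k))"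
  \<comment> \<open>The trial law: a word \<open>w\<close> has probability
    \<open>path_weight W w / Z (n + k)\<close>, and given \<open>w\<close> the cells are drawn
    independently, cell \<open>i\<close> by the kernel at the window starting at
    \<open>i\<close>.\<close>
  define R where "R z = path_weight W (snd z) / Z (n + k) * (\<Prod>i<n. \<kappa> (fst z ! i) (take k (drop i (snd z))))" for z
  have X: "?X \<in> measurable \<nu> (count_space ?I)"
    by (intro measurable_Pair_count_space measurable_itinerary measurable_prefix_word) (simp_all add: finite_Q)
  have R_X: "R (?X x) = path_weight W (?w x) / Z (n + k)
      * (\<Prod>i<n. \<kappa> (atom Q ((shift ^^ i) x)) (prefix_word k ((shift ^^ i) x)))" for x
    by (simp add: R_def window_prefix_word itinerary_def)
  have prod_pos': "0 < (\<Prod>i<n. \<kappa> (f i) (v i))" for f v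
    by (intro prod_pos \<kappa>_pos)
  have R_pos: "0 < R (?X x)" if "x \<in> Y" for x
    unfolding R_X by (intro mult_pos_pos divide_pos_pos prefix_word_weight_pos that Z_pos' prod_pos')
  have ln_R: "- ln (R (?X x)) = ln (Z (n + k)) - (\<Sum>i<n + k. \<phi> ((shift ^^ i) x)) + (\<Sum>i<n. c ((shift ^^ i) x))"
    if x: "x \<in> Y" for x
  proof -
    have W_eq: "W (x i) (x (Suc i)) = P (x i) (x (Suc i))" "0 < P (x i) (x (Suc i))" for i
      using x P_pos by (auto simp: shift_space_def edge_matrix_def)
    have "ln (R (?X x)) = ln (path_weight W (?w x)) - ln (Z (n + k))
        + ln (\<Prod>i<n. \<kappa> (atom Q ((shift ^^ i) x)) (prefix_word k ((shift ^^ i) x)))"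
      unfolding R_X using prefix_word_weight_pos[OF x, of "n + k"] Z_pos'[of "n + k"]
        prod_pos'[of "\<lambda>i. atom Q ((shift ^^ i) x)" "\<lambda>i. prefix_word k ((shift ^^ i) x)"]
      by (subst ln_mult_pos) (auto simp: ln_div)
    also have "ln (path_weight W (?w x)) = (\<Sum>i<n + k. \<phi> ((shift ^^ i) x))"
      unfolding path_weight_prefix_word W_eq using less_imp_neq[OF W_eq(2), symmetric]
      by (subst ln_prod) (simp_all add: funpow_shift One_nat_def)
    also have "ln (\<Prod>i<n. \<kappa> (atom Q ((shift ^^ i) x)) (prefix_word k ((shift ^^ i) x)))
        = - (\<Sum>i<n. c ((shift ^^ i) x))"
      using less_imp_neq[OF \<kappa>_pos, symmetric] by (subst ln_prod) (simp_all add: c_def sum_negf)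
    finally show ?thesis
      by simp
  qed
  have "rv_entropy \<nu> (itinerary shift Q n) (words Q n) \<le> rv_entropy \<nu> ?X ?I"
    by (intro rv_entropy_Pair_ge measurable_itinerary measurable_prefix_word) (simp_all add: finite_Q)
  also have "\<dots> \<le> (\<integral>x. - ln (R (?X x)) \<partial>\<nu>)"
  proof (rule rv_entropy_le_integral[OF X])
    show "finite ?I"
      by (simp add: finite_Q)
    show "0 \<le> R z" if "z \<in> ?I" for z
      using that unfolding R_def
      by (intro mult_nonneg_nonneg divide_nonneg_nonneg Z_nonneg less_imp_le[OF prod_pos'])
        (auto intro: weight_nonneg)
    \<comment> \<open>For a fixed word, the sum over itineraries factors into one kernel sum for
      each position, and each of these is at most \<open>1\<close>; the weights that remain are
      normalised by \<open>Z (n + k)\<close>.\<close>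
    have "sum R ?I = (\<Sum>w\<in>words {1..N} (Suc (n + k)). \<Sum>f\<in>words Q n. R (f, w))"
      unfolding sum.cartesian_product' by (rule sum.swap)
    also have "\<dots> = (\<Sum>w\<in>words {1..N} (Suc (n + k)). path_weight W w / Z (n + k) * (\<Prod>i<n. \<Sum>S\<in>Q. \<kappa> S (take k (drop i w))))"
    proof (intro sum.cong refl)
      fix w
      show "(\<Sum>f\<in>words Q n. R (f, w)) = path_weight W w / Z (n + k) * (\<Prod>i<n. \<Sum>S\<in>Q. \<kappa> S (take k (drop i w)))"
        using sum_words_prod[of "\<lambda>i S. \<kappa> S (take k (drop i w))" n Q]
        by (simp only: R_def fst_conv snd_conv sum_distrib_left[symmetric])
    qed
    also have "\<dots> \<le> (\<Sum>w\<in>words {1..N} (Suc (n + k)). path_weight W w / Z (n + k) * 1)"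
      by (intro sum_mono mult_left_mono prod_le_1 conjI \<kappa>_sum divide_nonneg_nonneg Z_nonneg
          sum_nonneg less_imp_le[OF \<kappa>_pos]) (rule weight_nonneg)
    also have "\<dots> = 1"
      using Z_pos'[of "n + k"] by (simp add: sum_divide_distrib[symmetric] partition_function_def[symmetric])
    finally show "sum R ?I \<le> 1" .
    show "AE x in \<nu>. 0 < R (?X x)"
      using Y_AE by eventually_elim (rule R_pos)
  qed
  also have "\<dots> = (\<integral>x. ln (Z (n + k)) - (\<Sum>i<n + k. \<phi> ((shift ^^ i) x)) + (\<Sum>i<n. c ((shift ^^ i) x)) \<partial>\<nu>)"
  proof (rule integral_cong_AE)
    show "(\<lambda>x. - ln (R (?X x))) \<in> borel_measurable \<nu>"
      by (rule borel_measurable_integrable, rule integrable_finite_valued[OF X]) (simp add: finite_Q)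
    show "(\<lambda>x. ln (Z (n + k)) - (\<Sum>i<n + k. \<phi> ((shift ^^ i) x)) + (\<Sum>i<n. c ((shift ^^ i) x))) \<in> borel_measurable \<nu>"
      by (intro borel_measurable_integrable Bochner_Integration.integrable_add Bochner_Integration.integrable_diff
          int_const sum_int_phi sum_int_c)
    show "AE x in \<nu>. - ln (R (?X x)) = ln (Z (n + k)) - (\<Sum>i<n + k. \<phi> ((shift ^^ i) x)) + (\<Sum>i<n. c ((shift ^^ i) x))"
      using Y_AE by eventually_elim (rule ln_R)
  qed
  also have "\<dots> = (\<integral>x. ln (Z (n + k)) \<partial>\<nu>) - (\<integral>x. (\<Sum>i<n + k. \<phi> ((shift ^^ i) x)) \<partial>\<nu>)
      + (\<integral>x. (\<Sum>i<n. c ((shift ^^ i) x)) \<partial>\<nu>)"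
    by (simp only: Bochner_Integration.integral_add[OF Bochner_Integration.integrable_diff[OF int_const sum_int_phi] sum_int_c]
        Bochner_Integration.integral_diff[OF int_const sum_int_phi])
  \<comment> \<open>By invariance all terms along the orbit have the same integral.\<close>
  also have "(\<integral>x. (\<Sum>i<n + k. \<phi> ((shift ^^ i) x)) \<partial>\<nu>) = real (n + k) * (\<integral>x. \<phi> x \<partial>\<nu>)"
    by (subst Bochner_Integration.integral_sum[OF integrable_iterate[OF int_phi]])
      (simp only: integral_iterate[OF borel_measurable_integrable[OF int_phi]] sum_constant card_lessThan)
  also have "(\<integral>x. (\<Sum>i<n. c ((shift ^^ i) x)) \<partial>\<nu>) = real n * (\<integral>x. c x \<partial>\<nu>)"
    by (subst Bochner_Integration.integral_sum[OF integrable_iterate[OF int_c]])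
      (simp only: integral_iterate[OF borel_measurable_integrable[OF int_c]] sum_constant card_lessThan)
  finally show ?thesis
    by (simp add: c_def[abs_def] prob_space)
qed

text \<open>The kernel puts mass \<open>1 - \<delta>\<close> on the guess \<open>g\<close> of the
  current cell and spreads \<open>\<delta>\<close> evenly over all cells. A correct guess then costs
  \<open>\<eta> / 2\<close>, and wrong guesses are too rare to cost more than another
  \<open>\<eta> / 2\<close> on average. Division by \<open>n\<close> removes the boundary
  terms.\<close>

lemma partition_entropy_plus_integral_le:
  assumes inv: "shift_invariant_prob \<nu> N" and Y1: "emeasure \<nu> Y = 1" and part: "partition_of \<nu> Q"
  shows "ereal (lim (\<lambda>n. partition_entropy \<nu> (iterated_join \<nu> shift Q n) / real n) + (\<integral>x. \<phi> x \<partial>\<nu>))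
    \<le> liminf (\<lambda>n. ereal (ln (Z n) / real n))"
proof -
  interpret shift_invariant_prob \<nu> N by fact
  interpret partition_of \<nu> Q by fact
  interpret preserved_partition \<nu> shift Q ..
  define h where "h = lim (\<lambda>n. partition_entropy \<nu> (iterated_join \<nu> shift Q n) / real n)"
  define I where "I = (\<integral>x. \<phi> x \<partial>\<nu>)"
  have h: "(\<lambda>n. partition_entropy \<nu> (iterated_join \<nu> shift Q n) / real n) \<longlonglongrightarrow> h"
    unfolding h_def by (rule LIMSEQ_partition_entropy)
  have "Y \<noteq> {}"
    using Y1 by (metis emeasure_empty zero_neq_one)
  then have Z_pos': "0 < Z m" for m
    using Z_pos by blast
  have "Q \<noteq> {}"
    using Union_Q not_empty by auto
  then have card_Q: "0 < card Q"
    using finite_Q by (simp add: card_gt_0_iff)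
  have "ereal (h + I) \<le> liminf (\<lambda>n. ereal (ln (Z n) / real n)) + ereal \<eta>" if \<eta>: "0 < \<eta>" for \<eta>
  proof -
    \<comment> \<open>Chosen so that \<open>- ln (1 - \<delta>) = \<eta> / 2\<close>, the cost of a
      correct guess.\<close>
    define \<delta> where "\<delta> = 1 - exp (- \<eta> / 2)"
    have \<delta>: "0 < \<delta>" "\<delta> < 1"
      using \<eta> by (auto simp: \<delta>_def)
    \<comment> \<open>\<open>b\<close> bounds the cost of a wrong guess, and \<open>e\<close> below
      is the error probability for which \<open>b * e \<le> \<eta> / 2\<close>.\<close>
    define b where "b = \<bar>ln (\<delta> / real (card Q))\<bar>"
    define e where "e = \<eta> / (2 * (b + 1))"
    have b: "0 \<le> b" and e: "0 < e"
      using \<eta> by (auto simp: b_def e_def intro!: divide_pos_pos)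
    obtain k g where kg: "prob {x \<in> space \<nu>. g (prefix_word k x) \<noteq> atom Q x} < e"
      using partition_approximation[OF part e] by blast
    let ?bad = "{x \<in> space \<nu>. g (prefix_word k x) \<noteq> atom Q x}"
    define \<kappa> where "\<kappa> S v = (if S = g v then 1 - \<delta> else \<delta> / real (card Q))" for S v
    define c where "c x = - ln (\<kappa> (atom Q x) (prefix_word k x))" for x
    have X: "(\<lambda>x. (atom Q x, prefix_word k x)) \<in> measurable \<nu> (count_space (Q \<times> words {1..N} k))"
      by (intro measurable_Pair_count_space measurable_atom measurable_prefix_word) (simp_all add: finite_Q)
    have int_c: "integrable \<nu> c"
      using integrable_finite_valued[OF X, of "\<lambda>z. - ln (\<kappa> (fst z) (snd z))"]
      by (simp add: finite_Q c_def[abs_def])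
    have "?bad = (\<lambda>x. (atom Q x, prefix_word k x)) -` {z \<in> Q \<times> words {1..N} k. g (snd z) \<noteq> fst z} \<inter> space \<nu>"
      using measurable_space[OF X] by auto
    also have "\<dots> \<in> events"
      by (rule measurable_sets[OF X]) simp
    finally have bad: "?bad \<in> events" .
    have "(\<integral>x. c x \<partial>\<nu>) \<le> (\<integral>x. \<eta> / 2 + b * indicator ?bad x \<partial>\<nu>)"
    proof (rule integral_mono)
      show "integrable \<nu> (\<lambda>x. \<eta> / 2 + b * indicator ?bad x)"
        using bad by (intro Bochner_Integration.integrable_add integrable_mult_right)
          (simp_all add: integrable_indicator_iff less_top[symmetric])
      show "c x \<le> \<eta> / 2 + b * indicator ?bad x" if "x \<in> space \<nu>" for x
        using that \<eta> by (auto simp: c_def \<kappa>_def \<delta>_def b_def)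
    qed (rule int_c)
    also have "\<dots> = \<eta> / 2 + b * prob ?bad"
      using bad by (subst Bochner_Integration.integral_add)
        (simp_all add: integrable_indicator_iff less_top[symmetric] prob_space Int_absorb1)
    also have "\<dots> \<le> \<eta> / 2 + b * e"
      using kg b by (intro add_left_mono mult_left_mono) auto
    also have "b * e \<le> \<eta> / 2"
      using b \<eta> by (simp add: e_def field_simps)
    finally have int_c_le: "(\<integral>x. c x \<partial>\<nu>) \<le> \<eta>"
      by simp
    have \<kappa>_sum: "(\<Sum>S\<in>Q. \<kappa> S v) \<le> 1" for v
    proof -
      have "(\<Sum>S\<in>Q. \<kappa> S v) \<le> (\<Sum>S\<in>Q. (if S = g v then 1 - \<delta> else 0) + \<delta> / real (card Q))"
        using \<delta> by (intro sum_mono) (auto simp: \<kappa>_def)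
      \<comment> \<open>The guess need not be a cell; in that case only the evenly spread mass
        \<open>\<delta>\<close> remains.\<close>
      also have "\<dots> = (if g v \<in> Q then 1 - \<delta> else 0) + \<delta>"
        using card_Q finite_Q \<open>Q \<noteq> {}\<close> by (simp add: sum.distrib)
      also have "\<dots> \<le> 1"
        using \<delta> by auto
      finally show ?thesis .
    qed
    have \<kappa>_pos: "0 < \<kappa> S v" for S v
      using \<delta> card_Q by (simp add: \<kappa>_def)
    have bound: "partition_entropy \<nu> (iterated_join \<nu> shift Q n) / real n + I + real k * I / real n - \<eta>
        \<le> ln (Z n) / real n" if n: "1 \<le> n" for n
    proof -
      have "partition_entropy \<nu> (iterated_join \<nu> shift Q n)
          \<le> ln (Z (n + k)) - real (n + k) * I + real n * (\<integral>x. c x \<partial>\<nu>)"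
        unfolding partition_entropy_iterated_join I_def c_def
        by (rule itinerary_entropy_le[OF inv Y1 part \<kappa>_pos \<kappa>_sum])
      \<comment> \<open>Monotonicity of \<open>Z\<close> absorbs the \<open>k\<close> extra edges;
        their contribution \<open>real k * I\<close> to the integral disappears after division by
        \<open>n\<close>.\<close>
      moreover have "ln (Z (n + k)) \<le> ln (Z n)"
        using Z_pos' antimonoD[OF Z_antimono, of n "n + k"] by (intro ln_mono) auto
      moreover have "real n * (\<integral>x. c x \<partial>\<nu>) \<le> real n * \<eta>"
        using int_c_le by (intro mult_left_mono) auto
      ultimately have "partition_entropy \<nu> (iterated_join \<nu> shift Q n) \<le> ln (Z n) - real (n + k) * I + real n * \<eta>"
        by linarith
      then have "partition_entropy \<nu> (iterated_join \<nu> shift Q n) / real n \<le> (ln (Z n) - real (n + k) * I + real n * \<eta>) / real n"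
        by (intro divide_right_mono) auto
      then show ?thesis
        using n by (simp add: add_divide_distrib diff_divide_distrib distrib_right)
    qed
    have "(\<lambda>n. partition_entropy \<nu> (iterated_join \<nu> shift Q n) / real n + I + real k * I / real n - \<eta>) \<longlonglongrightarrow> h + I + 0 - \<eta>"
      by (intro tendsto_intros h lim_const_over_n)
    then have "(\<lambda>n. ereal (partition_entropy \<nu> (iterated_join \<nu> shift Q n) / real n + I + real k * I / real n - \<eta>))
        \<longlonglongrightarrow> ereal (h + I - \<eta>)"
      by simp
    then have "ereal (h + I - \<eta>)
        = liminf (\<lambda>n. ereal (partition_entropy \<nu> (iterated_join \<nu> shift Q n) / real n + I + real k * I / real n - \<eta>))"
      by (intro lim_imp_Liminf[symmetric]) simp_all
    also have "\<dots> \<le> liminf (\<lambda>n. ereal (ln (Z n) / real n))"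
      using eventually_ge_at_top[of 1] by (intro Liminf_mono, eventually_elim) (simp add: bound)
    finally have "ereal (h + I - \<eta>) + ereal \<eta> \<le> liminf (\<lambda>n. ereal (ln (Z n) / real n)) + ereal \<eta>"
      by (rule add_right_mono)
    then show ?thesis
      by simp
  qed
  then have "ereal (h + I) \<le> liminf (\<lambda>n. ereal (ln (Z n) / real n))"
    by (rule ereal_le_epsilon2)
  then show ?thesis
    by (simp only: h_def I_def)
qed

lemma pressure_le_liminf: "pressure N Y \<phi> \<le> liminf (\<lambda>n. ereal (ln (Z n) / real n))"
  unfolding pressure_def
proof (rule SUP_least)
  fix \<nu> assume \<nu>: "\<nu> \<in> invariant_measures_on N Y"
  \<comment> \<open>The integral is a real number, so it can be moved to the other side before the
    supremum over partitions is taken.\<close>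
  have "ks_entropy \<nu> shift \<le> liminf (\<lambda>n. ereal (ln (Z n) / real n)) - ereal (\<integral>x. \<phi> x \<partial>\<nu>)"
    unfolding ks_entropy_def
  proof (rule SUP_least)
    fix Q assume "Q \<in> finite_measurable_partitions \<nu>"
    then have "partition_of \<nu> Q"
      by (rule partition_of.intro)
    then show "ereal (lim (\<lambda>n. partition_entropy \<nu> (iterated_join \<nu> shift Q n) / real n))
        \<le> liminf (\<lambda>n. ereal (ln (Z n) / real n)) - ereal (\<integral>x. \<phi> x \<partial>\<nu>)"
      using partition_entropy_plus_integral_le[of \<nu> Q] \<nu>
      by (simp add: shift_invariant_prob_iff ereal_le_minus)
  qed
  then show "ks_entropy \<nu> shift + ereal (\<integral>x. \<phi> x \<partial>\<nu>) \<le> liminf (\<lambda>n. ereal (ln (Z n) / real n))"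
    by (simp add: ereal_le_minus)
qed

end

section \<open>Stationary Markov measures\<close>

lemma path_weight_Cons:
  assumes "length w = Suc n"
  shows "path_weight M (a # w) = M a (w ! 0) * path_weight M w"
  using assms by (simp add: path_weight_def prod.lessThan_Suc_shift del: prod.lessThan_Suc)

context full_shift_prob
begin

lemma prefix_fibre: "prefix_word n -` {w} \<inter> space \<nu> \<in> sets \<nu>"
  using prefix_event[of n "{w}"] by (simp add: vimage_def Int_def conj_commute)

lemma prob_prefix_event:
  "prob {x \<in> space \<nu>. prefix_word n x \<in> D}
    = (\<Sum>w\<in>D \<inter> words {1..N} n. prob (prefix_word n -` {w} \<inter> space \<nu>))"
proof -
  have "{x \<in> space \<nu>. prefix_word n x \<in> D} = (\<Union>w\<in>D \<inter> words {1..N} n. prefix_word n -` {w} \<inter> space \<nu>)"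
    using measurable_space[OF measurable_prefix_word] by auto
  then show ?thesis
    using prefix_fibre
    by (simp only:) (rule finite_measure_finite_Union, auto simp: disjoint_family_on_def)
qed

end

text \<open>Events determined by a prefix form an intersection-stable generator, since the longer
  prefix decides both of two such events, and their measure is a finite sum of word
  probabilities.\<close>

lemma full_shift_prob_eqI:
  assumes "full_shift_prob \<nu> N" and "full_shift_prob \<nu>' N"
    and eq: "\<And>n w. w \<in> words {1..N} n \<Longrightarrow>
      measure \<nu> (prefix_word n -` {w} \<inter> space \<nu>) = measure \<nu>' (prefix_word n -` {w} \<inter> space \<nu>')"
  shows "\<nu> = \<nu>'"
proof -
  interpret full_shift_prob \<nu> N by fact
  interpret \<nu>': full_shift_prob \<nu>' N by fact
  have space_eq: "space \<nu>' = space \<nu>"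
    by (simp add: space_nu \<nu>'.space_nu)
  let ?E = "{{x \<in> space \<nu>. prefix_word n x \<in> D} | n D. True}"
  have E_sub: "?E \<subseteq> sets \<nu>"
    using prefix_event by auto
  have gen: "sets \<nu> = sigma_sets (space \<nu>) ?E"
  proof
    have "{x \<in> space \<nu>. x i \<in> A} = {x \<in> space \<nu>. prefix_word (Suc i) x \<in> {w. w ! i \<in> A}}" for i A
      by simp
    then have "{{x \<in> space \<nu>. x i \<in> A} | i A. A \<subseteq> {1..N}} \<subseteq> ?E"
      by blast
    then show "sets \<nu> \<subseteq> sigma_sets (space \<nu>) ?E"
      unfolding sets_nu_generated by (rule sigma_sets_mono')
    show "sigma_sets (space \<nu>) ?E \<subseteq> sets \<nu>"
      using E_sub by (rule sets.sigma_sets_subset)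
  qed
  show ?thesis
  proof (rule measure_eqI_generator_eq[where E = ?E and \<Omega> = "space \<nu>" and A = "\<lambda>_. space \<nu>"])
    show "Int_stable ?E"
    proof (rule Int_stableI)
      fix a b assume "a \<in> ?E" "b \<in> ?E"
      then obtain m C n D where ab: "a = {x \<in> space \<nu>. prefix_word m x \<in> C}" "b = {x \<in> space \<nu>. prefix_word n x \<in> D}"
        by auto
      have "a \<inter> b = {x \<in> space \<nu>. prefix_word (m + n) x \<in> {w. take m w \<in> C \<and> take n w \<in> D}}"
        by (auto simp: ab take_prefix_word)
      then show "a \<inter> b \<in> ?E"
        by blast
    qed
    show "?E \<subseteq> Pow (space \<nu>)"
      by auto
    show "emeasure \<nu> X = emeasure \<nu>' X" if X: "X \<in> ?E" for X
    proof -
      obtain n D where X_eq: "X = {x \<in> space \<nu>. prefix_word n x \<in> D}"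
        using X by auto
      have "measure \<nu> X = measure \<nu>' X"
        unfolding X_eq prob_prefix_event using \<nu>'.prob_prefix_event[of n D] eq
        by (simp add: space_eq)
      then show ?thesis
        by (simp add: emeasure_eq_measure \<nu>'.emeasure_eq_measure)
    qed
    show "sets \<nu> = sigma_sets (space \<nu>) ?E"
      by (rule gen)
    show "sets \<nu>' = sigma_sets (space \<nu>) ?E"
      using gen sets_nu \<nu>'.sets_nu by simp
    have "space \<nu> = {x \<in> space \<nu>. prefix_word 0 x \<in> UNIV}"
      by simp
    then show "range (\<lambda>_. space \<nu>) \<subseteq> ?E"
      by blast
  qed (simp_all add: emeasure_space_1)
qed

text \<open>Ionescu-Tulcea construction with the initial law \<open>\<pi>\<close> and with the row
  of \<open>K\<close> at the last letter as transition law. What remains is to compute the mass of a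
  single word.\<close>

lemma markov_measure_exists:
  fixes \<pi> :: "nat \<Rightarrow> real" and K :: "nat \<Rightarrow> nat \<Rightarrow> real"
  assumes \<pi>: "\<And>i. i \<in> {1..N} \<Longrightarrow> 0 \<le> \<pi> i" "(\<Sum>i\<in>{1..N}. \<pi> i) = 1"
    and K: "row_stochastic N K"
  shows "\<exists>\<nu>. full_shift_prob \<nu> N \<and> (\<forall>n. \<forall>w\<in>words {1..N} (Suc n).
    measure \<nu> (prefix_word (Suc n) -` {w} \<inter> space \<nu>) = \<pi> (w ! 0) * path_weight K w)"
proof -
  define pt where "pt f = point_measure {1..N} (\<lambda>j. ennreal (f j))" for f :: "nat \<Rightarrow> real"
  \<comment> \<open>\<open>ker n\<close> draws the letter with index \<open>n\<close>; the first
    draw uses \<open>\<pi>\<close>, every later one depends only on the letter with index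
    \<open>n - 1\<close>.\<close>
  define ker where "ker n x = pt (if n = 0 then \<pi> else K (x (n - 1)))" for n and x :: "nat \<Rightarrow> nat"
  let ?M = "\<lambda>_::nat. count_space {1..N}"
  have pt: "prob_space (pt f)" if "\<And>i. i \<in> {1..N} \<Longrightarrow> 0 \<le> f i" "(\<Sum>i\<in>{1..N}. f i) = 1" for f
    unfolding pt_def using that by (intro prob_space_point_measure) (simp_all, subst sum_ennreal, simp_all)
  have sets_pt: "sets (pt f) = sets (count_space {1..N})" for f
    by (simp add: pt_def sets_point_measure)
  have pt_\<pi>: "prob_space (pt \<pi>)"
    using \<pi> by (rule pt)
  have pt_K: "prob_space (pt (K i))" if "i \<in> {1..N}" for i
    using K that by (intro pt) (auto simp: row_stochastic_def)
  have in_sub: "pt f \<in> space (subprob_algebra (count_space {1..N}))" if "prob_space (pt f)" for f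
    using that sets_pt by (simp add: space_subprob_algebra prob_space_imp_subprob_space)
  have ker_measurable: "ker n \<in> measurable (PiM {0..<n} ?M) (subprob_algebra (count_space {1..N}))" for n
  proof (cases n)
    case 0
    then have "ker n = (\<lambda>_. pt \<pi>)"
      by (auto simp: ker_def)
    then show ?thesis
      using in_sub[OF pt_\<pi>] by (simp add: measurable_const)
  next
    case (Suc m)
    then have ker_eq: "ker n = (\<lambda>x. pt (K (x m)))"
      by (auto simp: ker_def)
    have "(\<lambda>i. pt (K i)) \<in> measurable (count_space {1..N}) (subprob_algebra (count_space {1..N}))"
      unfolding measurable_count_space_eq1 using in_sub[OF pt_K] by blast
    moreover have "(\<lambda>x. x m) \<in> measurable (PiM {0..<n} ?M) (count_space {1..N})"
      using Suc by (intro measurable_component_singleton) simp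
    ultimately show ?thesis
      unfolding ker_eq by (rule measurable_compose[rotated])
  qed
  have ker_prob: "prob_space (ker n x)" if "x \<in> space (PiM {0..<n} ?M)" for n x
  proof (cases n)
    case (Suc m)
    then have "x m \<in> {1..N}"
      using that by (auto simp: space_PiM PiE_iff)
    then show ?thesis
      using pt_K Suc by (simp add: ker_def)
  qed (simp add: ker_def pt_\<pi>)
  interpret Ionescu_Tulcea ker ?M
    by (rule Ionescu_Tulcea.intro[OF ker_measurable ker_prob])
  \<comment> \<open>The only point of the product over the empty index set, from which the
    construction starts.\<close>
  let ?u = "\<lambda>x::nat. undefined :: nat"
  have single: "{f} \<in> sets (PiM {0..<n} ?M)" if "f \<in> space (PiM {0..<n} ?M)" for f n
  proof -
    have "{f} = PiE {0..<n} (\<lambda>i. {f i})"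
      using that by (intro PiE_singleton[symmetric]) (auto simp: space_PiM PiE_iff)
    also have "\<dots> \<in> sets (PiM {0..<n} ?M)"
      using that by (intro sets_PiM_I_finite) (auto simp: space_PiM PiE_iff)
    finally show ?thesis .
  qed
  have C_step: "emeasure (C 0 (Suc n) ?u) {f}
      = emeasure (C 0 n ?u) {restrict f {0..<n}} * emeasure (ker n (restrict f {0..<n})) {f n}"
    if f: "f \<in> space (PiM {0..<Suc n} ?M)" for n f
  proof -
    let ?f = "restrict f {0..<n}"
    have u: "?u \<in> space (PiM {0..<0} ?M)"
      by simp
    have f': "?f \<in> space (PiM {0..<n} ?M)"
      using f by (auto simp: space_PiM PiE_iff)
    have sp: "space (C 0 n ?u) = space (PiM {0..<n} ?M)"
      using space_C[OF u, of n] by simp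
    have st: "sets (C 0 n ?u) = sets (PiM {0..<n} ?M)"
      using sets_C[OF u, of n] by simp
    have "emeasure (C 0 (Suc n) ?u) {f} = (\<integral>\<^sup>+\<omega>. emeasure (eP n \<omega>) {f} \<partial>C 0 n ?u)"
      unfolding C.simps add_0
    proof (rule emeasure_bind)
      show "space (C 0 n ?u) \<noteq> {}"
        unfolding sp using f' by blast
      show "eP n \<in> measurable (C 0 n ?u) (subprob_algebra (PiM {0..<Suc n} ?M))"
        unfolding measurable_cong_sets[OF st refl] by (rule measurable_eP)
      show "{f} \<in> sets (PiM {0..<Suc n} ?M)"
        by (rule single[OF f])
    qed
    \<comment> \<open>Updating \<open>\<omega>\<close> at \<open>n\<close> yields \<open>f\<close>
      only if \<open>\<omega>\<close> is the restriction of \<open>f\<close> and the new letter is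
      \<open>f n\<close>; the integrand is therefore supported on one point.\<close>
    also have "\<dots> = (\<integral>\<^sup>+\<omega>. emeasure (ker n ?f) {f n} * indicator {?f} \<omega> \<partial>C 0 n ?u)"
    proof (rule nn_integral_cong)
      fix \<omega> assume "\<omega> \<in> space (C 0 n ?u)"
      then have \<omega>: "\<omega> \<in> space (PiM {0..<n} ?M)"
        by (simp add: sp)
      have fn: "f n \<in> {1..N}" and ext: "f \<in> extensional {0..<Suc n}"
        using f by (auto simp: space_PiM PiE_iff)
      have "emeasure (eP n \<omega>) {f} = emeasure (ker n \<omega>) ((\<lambda>x. fun_upd \<omega> n x) -` {f} \<inter> {1..N})"
        using emeasure_eP[OF \<omega> single[OF f]] by simp
      also have "(\<lambda>x. fun_upd \<omega> n x) -` {f} \<inter> {1..N} = (if \<omega> = ?f then {f n} else {})"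
      proof -
        have "fun_upd \<omega> n x = f \<longleftrightarrow> \<omega> = ?f \<and> x = f n" for x
        proof
          assume eq: "fun_upd \<omega> n x = f"
          have "\<omega> i = ?f i" for i
          proof (cases "i < n")
            case True
            then show ?thesis using fun_cong[OF eq, of i] by auto
          next
            case False
            then show ?thesis using \<omega> by (auto simp: space_PiM PiE_iff extensional_def)
          qed
          then show "\<omega> = ?f \<and> x = f n"
            using fun_cong[OF eq, of n] by auto
        next
          assume "\<omega> = ?f \<and> x = f n"
          then show "fun_upd \<omega> n x = f"
            using ext by (auto simp: fun_eq_iff restrict_def extensional_def)
        qed
        then have "(\<lambda>x. fun_upd \<omega> n x) -` {f} = {x. \<omega> = ?f \<and> x = f n}"
          by (simp only: vimage_def singleton_iff)
        moreover have "{x. b \<and> x = c} \<inter> S = (if b then {c} else {})" if "c \<in> S" for b and c :: nat and S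
          using that by auto
        ultimately show ?thesis
          using fn by (simp only:)
      qed
      finally show "emeasure (eP n \<omega>) {f} = emeasure (ker n ?f) {f n} * indicator {?f} \<omega>"
        by (cases "\<omega> = ?f") (simp_all only: if_True if_False simp_thms emeasure_empty indicator_simps singleton_iff mult_1_right mult_zero_right not_False_eq_True)
    qed
    also have "\<dots> = emeasure (ker n ?f) {f n} * emeasure (C 0 n ?u) {?f}"
      using single[OF f'] st by (subst nn_integral_cmult_indicator) auto
    finally show ?thesis
      by (simp add: mult.commute)
  qed
  have ker_single: "emeasure (pt f) {j} = ennreal (f j)" if "j \<in> {1..N}" for f j
    using that by (simp add: pt_def emeasure_point_measure_finite)
  have C_0: "emeasure (C 0 0 ?u) {?u} = 1"
    using single[of ?u 0] unfolding C.simps(1) by (subst emeasure_return) simp_all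
  have C_word: "emeasure (C 0 (Suc n) ?u) {restrict f {0..<Suc n}} = ennreal (\<pi> (f 0) * (\<Prod>i<n. K (f i) (f (Suc i))))"
    if f: "\<And>i. f i \<in> {1..N}" for n f
  proof (induction n)
    case 0
    have "restrict f {0..<Suc 0} \<in> space (PiM {0..<Suc 0} ?M)"
      using f by (auto simp: space_PiM PiE_iff)
    moreover have "restrict (restrict f {0..<Suc 0}) {0..<0} = ?u"
      by (auto simp: restrict_def)
    moreover have "restrict f {0..<Suc 0} 0 = f 0"
      by simp
    ultimately have "emeasure (C 0 (Suc 0) ?u) {restrict f {0..<Suc 0}} = emeasure (C 0 0 ?u) {?u} * emeasure (ker 0 ?u) {f 0}"
      using C_step[of "restrict f {0..<Suc 0}" 0] by (simp only:)
    also have "\<dots> = ennreal (\<pi> (f 0))"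
      using f[of 0] by (simp only: C_0 mult_1_left) (simp add: ker_def ker_single)
    finally show ?case
      by (simp only: lessThan_0 prod.empty mult_1_right)
  next
    case (Suc n)
    have "restrict f {0..<Suc (Suc n)} \<in> space (PiM {0..<Suc (Suc n)} ?M)"
      using f by (auto simp: space_PiM PiE_iff)
    moreover have "restrict (restrict f {0..<Suc (Suc n)}) {0..<Suc n} = restrict f {0..<Suc n}"
      by (simp add: restrict_restrict Int_absorb1)
    ultimately have "emeasure (C 0 (Suc (Suc n)) ?u) {restrict f {0..<Suc (Suc n)}}
        = emeasure (C 0 (Suc n) ?u) {restrict f {0..<Suc n}} * ennreal (K (f n) (f (Suc n)))"
      using C_step[of "restrict f {0..<Suc (Suc n)}" "Suc n"] f[of "Suc n"]
      by (simp only:) (simp add: ker_def ker_single del: C.simps)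
    also have "\<dots> = ennreal (\<pi> (f 0) * (\<Prod>i<n. K (f i) (f (Suc i)))) * ennreal (K (f n) (f (Suc n)))"
      by (simp only: Suc.IH)
    also have "\<dots> = ennreal (\<pi> (f 0) * (\<Prod>i<n. K (f i) (f (Suc i))) * K (f n) (f (Suc n)))"
      using K f \<pi>(1) by (intro ennreal_mult[symmetric] mult_nonneg_nonneg prod_nonneg) (auto simp: row_stochastic_def)
    finally show ?case
      by (simp only: prod.lessThan_Suc mult.assoc)
  qed
  \<comment> \<open>On a cylinder the projective limit agrees with the finite-dimensional law, so
    the word masses computed for \<open>C\<close> carry over.\<close>
  have lim_fibre: "emeasure PF.lim (prod_emb UNIV ?M {0..<n} {f}) = emeasure (C 0 n ?u) {f}"
    if f: "f \<in> space (PiM {0..<n} ?M)" for n f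
  proof -
    have "emeasure PF.lim (prod_emb UNIV ?M {0..<n} {f}) = emeasure (CI {0..<n}) {f}"
      by (rule lim) (simp_all add: single[OF f])
    also have "\<dots> = emeasure (C 0 n ?u) (prod_emb {0..<n} ?M {0..<n} {f})"
      by (rule emeasure_CI) (simp_all add: single[OF f])
    also have "prod_emb {0..<n} ?M {0..<n} {f} = {f}"
      using f by (intro prod_emb_id) (simp add: space_PiM)
    finally show ?thesis .
  qed
  have space_lim: "space PF.lim = {x. \<forall>i. x i \<in> {1..N}}"
    by (auto simp: space_PiM PiE_iff)
  have emb_eq: "prod_emb UNIV ?M {0..<n} {restrict f {0..<n}} = {x \<in> space PF.lim. \<forall>i<n. x i = f i}" for n f
  proof -
    have "restrict x {0..<n} = restrict f {0..<n} \<longleftrightarrow> (\<forall>i<n. x i = f i)" for x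
    proof
      assume eq: "restrict x {0..<n} = restrict f {0..<n}"
      show "\<forall>i<n. x i = f i"
        using fun_cong[OF eq] by (metis atLeastLessThan_iff restrict_apply' zero_le)
    qed (auto intro!: restrict_ext)
    then show ?thesis
      unfolding space_lim prod_emb_def by (auto simp: PiE_iff)
  qed
  have "prob_space PF.lim"
  proof (rule prob_spaceI)
    have "emeasure PF.lim (prod_emb UNIV ?M {0..<0} {?u}) = emeasure (C 0 0 ?u) {?u}"
      by (rule lim_fibre) simp
    also have "\<dots> = 1"
      by (rule C_0)
    also have "prod_emb UNIV ?M {0..<0} {?u} = space PF.lim"
      using emb_eq[of 0 ?u] by (simp add: restrict_def)
    finally show "emeasure PF.lim (space PF.lim) = 1" .
  qed
  then have fs: "full_shift_prob PF.lim N"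
    by (intro full_shift_prob.intro full_shift_prob_axioms.intro) (simp_all add: full_shift_measure_def)
  moreover have "measure PF.lim (prefix_word (Suc n) -` {w} \<inter> space PF.lim) = \<pi> (w ! 0) * path_weight K w"
    if w: "w \<in> words {1..N} (Suc n)" for n w
  proof -
    \<comment> \<open>The word is continued by repeating its last letter, so that \<open>f\<close>
      is defined at all indices and stays in the alphabet.\<close>
    define f where "f i = w ! min i n" for i
    have f: "f i \<in> {1..N}" for i
      unfolding f_def using w by (intro nth_words) auto
    have "prefix_word (Suc n) -` {w} \<inter> space PF.lim = {x \<in> space PF.lim. \<forall>i<Suc n. x i = f i}"
      using prefix_word_eq_iff[OF length_words[OF w]] by (auto simp: f_def min_absorb1)
    also have "\<dots> = prod_emb UNIV ?M {0..<Suc n} {restrict f {0..<Suc n}}"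
      by (rule emb_eq[symmetric])
    finally have "emeasure PF.lim (prefix_word (Suc n) -` {w} \<inter> space PF.lim)
        = ennreal (\<pi> (f 0) * (\<Prod>i<n. K (f i) (f (Suc i))))"
      using f by (simp only:) (subst lim_fibre, simp add: space_PiM PiE_iff, rule C_word)
    moreover have "\<pi> (f 0) * (\<Prod>i<n. K (f i) (f (Suc i))) = \<pi> (w ! 0) * path_weight K w"
      by (simp add: f_def path_weight_def length_words[OF w] min_absorb1)
    moreover have "0 \<le> \<pi> (f 0) * (\<Prod>i<n. K (f i) (f (Suc i)))"
      using K f \<pi>(1) by (intro mult_nonneg_nonneg prod_nonneg) (auto simp: row_stochastic_def)
    ultimately show ?thesis
      by (simp add: measure_def)
  qed
  ultimately show ?thesis
    by blast
qed

section \<open>The lower bound for the pressure\<close>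

context full_shift_prob
begin

lemma measurable_shift: "shift \<in> measurable \<nu> \<nu>"
proof -
  have "(\<lambda>x i. x (Suc i)) \<in> measurable \<nu> (full_shift_measure N)"
    unfolding full_shift_measure_def
    by (rule measurable_PiM_single') (auto simp: measurable_coordinate space_nu)
  then show ?thesis
    unfolding measurable_cong_sets[OF refl sets_nu] by (simp add: shift_def[abs_def])
qed

lemma distr_shift_full_shift: "full_shift_prob (distr \<nu> \<nu> shift) N"
  using prob_space_distr[OF measurable_shift] sets_nu
  by (simp add: full_shift_prob_def full_shift_prob_axioms_def)

lemma sets_shift_space: "shift_space N B \<in> sets \<nu>"
proof -
  have "shift_space N B = (\<Inter>i. {x \<in> space \<nu>. prefix_word (Suc (Suc i)) x \<in> {w. B (w ! i) (w ! Suc i) = 1}})"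
    by (auto simp: shift_space_def space_nu)
  also have "\<dots> \<in> sets \<nu>"
    using prefix_event by (intro sets.countable_INT') blast+
  finally show ?thesis .
qed

text \<open>The one-letter cylinders form the partition whose entropy rate bounds the entropy of a
  Markov measure from below.\<close>

definition letter :: "nat \<Rightarrow> (nat \<Rightarrow> nat) set" where
  "letter a = {x \<in> space \<nu>. x 0 = a}"

lemma letter_partition: "letter ` {1..N} \<in> finite_measurable_partitions \<nu>"
proof -
  have "letter a = (\<lambda>x. x 0) -` {a} \<inter> space \<nu>" for a
    by (auto simp: letter_def)
  then have "letter a \<in> sets \<nu>" if "a \<in> {1..N}" for a
    using measurable_sets[OF measurable_coordinate[of 0], of "{a}"] that by simp
  moreover have "(\<Union>a\<in>{1..N}. letter a) = space \<nu>"
    by (auto simp: letter_def space_nu)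
  moreover have "disjoint (letter ` {1..N})"
    by (auto simp: disjoint_def letter_def)
  ultimately show ?thesis
    by (auto simp: finite_measurable_partitions_def)
qed

text \<open>Constant sequences show that the cells are nonempty, hence different for different
  letters.\<close>

lemma inj_on_letter: "inj_on letter {1..N}"
proof (rule inj_onI)
  fix a b assume a: "a \<in> {1..N}" and eq: "letter a = letter b"
  have "(\<lambda>_. a) \<in> letter a"
    using a by (simp add: letter_def space_nu)
  then show "a = b"
    unfolding eq by (simp add: letter_def)
qed

end

context shift_invariant_prob
begin

sublocale letters: preserved_partition \<nu> shift "letter ` {1..N}"
  by unfold_locales (rule letter_partition)

lemma itinerary_letter:
  assumes x: "x \<in> space \<nu>"
  shows "itinerary shift (letter ` {1..N}) n x = map letter (prefix_word n x)"
proof -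
  have "atom (letter ` {1..N}) ((shift ^^ i) x) = letter (x i)" for i
  proof (rule letters.atom_eqI)
    show "(shift ^^ i) x \<in> letter (x i)"
      using x by (auto simp: letter_def space_nu funpow_shift)
    show "letter (x i) \<in> letter ` {1..N}"
      using x by (auto simp: space_nu)
  qed
  then show ?thesis
    by (simp add: itinerary_def prefix_word_def)
qed

lemma entropy_letters:
  "partition_entropy \<nu> (iterated_join \<nu> shift (letter ` {1..N}) n) = rv_entropy \<nu> (prefix_word n) (words {1..N} n)"
proof -
  have inj: "inj_on (map letter) (words {1..N} n)"
    by (rule inj_on_subset[OF inj_on_mapI[of _ "words {1..N} n"]])
      (auto intro!: inj_on_subset[OF inj_on_letter] simp: words_def)
  have "words (letter ` {1..N}) n = map letter ` words {1..N} n"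
  proof -
    have "words (letter ` {1..N}) n = lists (letter ` {1..N}) \<inter> {w. length w = n}"
      by (auto simp: words_def)
    also have "\<dots> = map letter ` words {1..N} n"
      unfolding lists_image by (auto simp: words_def)
    finally show ?thesis .
  qed
  moreover have "itinerary shift (letter ` {1..N}) n -` {map letter w} \<inter> space \<nu> = prefix_word n -` {w} \<inter> space \<nu>"
    if w: "w \<in> words {1..N} n" for w
  proof -
    have "map letter (prefix_word n x) = map letter w \<longleftrightarrow> prefix_word n x = w" if "x \<in> space \<nu>" for x
      using inj_on_eq_iff[OF inj measurable_space[OF measurable_prefix_word that, simplified space_count_space] w] .
    then show ?thesis
      using itinerary_letter[of _ n] by auto
  qed
  ultimately show ?thesis
    unfolding letters.partition_entropy_iterated_join rv_entropy_def
    by (simp add: sum.reindex[OF inj])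
qed

end

text \<open>The preimage of a word event under the shift is the union over all possible first
  letters, and stationarity sums that letter out. Measures on the full shift are determined by their
  word probabilities.\<close>

lemma markov_shift_invariant:
  assumes fs: "full_shift_prob \<nu> N"
    and law: "\<And>n w. w \<in> words {1..N} (Suc n) \<Longrightarrow>
      measure \<nu> (prefix_word (Suc n) -` {w} \<inter> space \<nu>) = \<pi> (w ! 0) * path_weight K w"
    and stat: "\<And>j. j \<in> {1..N} \<Longrightarrow> (\<Sum>i\<in>{1..N}. \<pi> i * K i j) = \<pi> j"
  shows "shift_invariant_prob \<nu> N"
proof -
  interpret full_shift_prob \<nu> N by fact
  interpret S: full_shift_prob "distr \<nu> \<nu> shift" N
    by (rule distr_shift_full_shift)
  have "distr \<nu> \<nu> shift = \<nu>"
  proof (rule full_shift_prob_eqI[OF distr_shift_full_shift fs])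
    fix n w assume w: "w \<in> words {1..N} n"
    show "measure (distr \<nu> \<nu> shift) (prefix_word n -` {w} \<inter> space (distr \<nu> \<nu> shift))
        = prob (prefix_word n -` {w} \<inter> space \<nu>)"
    proof (cases n)
      case 0
      then have "w = []"
        using w by simp
      then have "prefix_word n -` {w} = UNIV"
        using 0 by (auto simp: prefix_word_def)
      then show ?thesis
        using S.prob_space prob_space by simp
    next
      case (Suc m)
      have "measure (distr \<nu> \<nu> shift) (prefix_word n -` {w} \<inter> space (distr \<nu> \<nu> shift))
          = prob (shift -` (prefix_word n -` {w} \<inter> space \<nu>) \<inter> space \<nu>)"
        using measure_distr[OF measurable_shift prefix_fibre[of n w]] by simp
      also have "shift -` (prefix_word n -` {w} \<inter> space \<nu>) \<inter> space \<nu>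
          = {x \<in> space \<nu>. prefix_word (Suc n) x \<in> {v. drop 1 v = w}}"
      proof -
        have "drop 1 (prefix_word (Suc n) x) = prefix_word n (shift x)" for x
          by (auto simp: list_eq_iff_nth_eq shift_def One_nat_def)
        then show ?thesis
          using measurable_space[OF measurable_shift] by auto
      qed
      also have "prob \<dots> = (\<Sum>v\<in>{v. drop 1 v = w} \<inter> words {1..N} (Suc n). \<pi> (v ! 0) * path_weight K v)"
        unfolding prob_prefix_event by (intro sum.cong refl law) simp
      also have "\<dots> = (\<Sum>i\<in>{1..N}. \<pi> i * path_weight K (i # w))"
      proof -
        have "{v. drop 1 v = w} \<inter> words {1..N} (Suc n) = (\<lambda>i. i # w) ` {1..N}"
        proof (rule set_eqI)
          fix v
          show "v \<in> {v. drop 1 v = w} \<inter> words {1..N} (Suc n) \<longleftrightarrow> v \<in> (\<lambda>i. i # w) ` {1..N}"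
            using w by (cases v) (auto simp: words_def One_nat_def)
        qed
        then show ?thesis
          by (simp add: sum.reindex inj_on_def)
      qed
      also have "\<dots> = (\<Sum>i\<in>{1..N}. \<pi> i * K i (w ! 0)) * path_weight K w"
        using length_words[OF w] Suc by (simp add: path_weight_Cons[where n = m] sum_distrib_right mult.assoc)
      also have "\<dots> = \<pi> (w ! 0) * path_weight K w"
        using w Suc by (simp add: stat nth_words del: atLeastAtMost_iff)
      also have "\<dots> = prob (prefix_word n -` {w} \<inter> space \<nu>)"
        using w Suc by (simp add: law)
      finally show ?thesis .
    qed
  qed
  then show ?thesis
    using measurable_shift by unfold_locales
qed

text \<open>The functional \<open>F\<close> for a chain with edge law \<open>q\<close>, written with
  terms of the form \<open>x * ln x\<close>. These are continuous also at \<open>0\<close>, so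
  limits of \<open>q\<close> can be taken even when a row of \<open>q\<close> vanishes in the limit.
  Conditional probabilities appear in \<open>edge_pressure_eq\<close>.\<close>

definition edge_pressure :: "nat \<Rightarrow> (nat \<Rightarrow> nat \<Rightarrow> real) \<Rightarrow> (nat \<Rightarrow> nat \<Rightarrow> real) \<Rightarrow> real" where
  "edge_pressure N P q = (\<Sum>i\<in>{1..N}. \<Sum>j\<in>{1..N}. q i j * ln (P i j) - q i j * ln (q i j))
    + (\<Sum>i\<in>{1..N}. (\<Sum>j\<in>{1..N}. q i j) * ln (\<Sum>j\<in>{1..N}. q i j))"

lemma edge_pressure_eq:
  assumes q: "\<And>i j. i \<in> {1..N} \<Longrightarrow> j \<in> {1..N} \<Longrightarrow> 0 \<le> q i j"
  shows "edge_pressure N P q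
    = (\<Sum>i\<in>{1..N}. \<Sum>j\<in>{1..N}. q i j * (ln (P i j) - ln (q i j / (\<Sum>k\<in>{1..N}. q i k))))"
proof -
  have "edge_pressure N P q
      = (\<Sum>i\<in>{1..N}. \<Sum>j\<in>{1..N}. q i j * ln (P i j) - q i j * ln (q i j) + q i j * ln (\<Sum>k\<in>{1..N}. q i k))"
    by (simp add: edge_pressure_def sum.distrib sum_distrib_right)
  also have "\<dots> = (\<Sum>i\<in>{1..N}. \<Sum>j\<in>{1..N}. q i j * (ln (P i j) - ln (q i j / (\<Sum>k\<in>{1..N}. q i k))))"
  proof (intro sum.cong refl)
    fix i j assume i: "i \<in> {1..N}" and j: "j \<in> {1..N}"
    have le: "q i j \<le> (\<Sum>k\<in>{1..N}. q i k)"
      using q i j by (intro member_le_sum) auto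
    show "q i j * ln (P i j) - q i j * ln (q i j) + q i j * ln (\<Sum>k\<in>{1..N}. q i k)
        = q i j * (ln (P i j) - ln (q i j / (\<Sum>k\<in>{1..N}. q i k)))"
    proof (cases "q i j = 0")
      case False
      then have "0 < q i j" "0 < (\<Sum>k\<in>{1..N}. q i k)"
        using q[OF i j] le by auto
      then show ?thesis
        by (simp add: ln_div algebra_simps)
    qed simp
  qed
  finally show ?thesis .
qed

context weighted_shift
begin

text \<open>The witness is the Markov measure with edge law \<open>q\<close>. Equal row and column
  sums make it invariant, the support of \<open>q\<close> places it on \<open>Y\<close>, and the
  entropy rate of its letters together with the integral of \<open>\<phi>\<close> is
  \<open>edge_pressure N P q\<close>.\<close>

lemma edge_pressure_le_pressure:
  assumes q_nonneg: "\<And>i j. i \<in> {1..N} \<Longrightarrow> j \<in> {1..N} \<Longrightarrow> 0 \<le> q i j"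
    and q_sum: "(\<Sum>i\<in>{1..N}. \<Sum>j\<in>{1..N}. q i j) = 1"
    and q_stat: "\<And>i. i \<in> {1..N} \<Longrightarrow> (\<Sum>j\<in>{1..N}. q i j) = (\<Sum>j\<in>{1..N}. q j i)"
    and q_supp: "\<And>i j. i \<in> {1..N} \<Longrightarrow> j \<in> {1..N} \<Longrightarrow> 0 < q i j \<Longrightarrow> B i j = 1"
  shows "ereal (edge_pressure N P q) \<le> pressure N Y \<phi>"
proof -
  define \<pi> where "\<pi> i = (\<Sum>j\<in>{1..N}. q i j)" for i
  \<comment> \<open>On a row of mass zero the quotient would give the zero row; the probability
    vector \<open>\<pi>\<close> takes its place so that \<open>K\<close> is stochastic.\<close>
  define K where "K i j = (if \<pi> i = 0 then \<pi> j else q i j / \<pi> i)" for i j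
  have \<pi>_nonneg: "0 \<le> \<pi> i" if "i \<in> {1..N}" for i
    unfolding \<pi>_def using q_nonneg that by (intro sum_nonneg) auto
  have \<pi>_sum: "(\<Sum>i\<in>{1..N}. \<pi> i) = 1"
    using q_sum by (simp add: \<pi>_def)
  have q_le: "q i j \<le> \<pi> i" if "i \<in> {1..N}" "j \<in> {1..N}" for i j
    unfolding \<pi>_def using q_nonneg that by (intro member_le_sum) auto
  have \<pi>K: "\<pi> i * K i j = q i j" if "i \<in> {1..N}" "j \<in> {1..N}" for i j
    using q_le[OF that] q_nonneg[OF that] by (auto simp: K_def)
  have K_stoch: "row_stochastic N K"
    unfolding row_stochastic_def
  proof (intro ballI conjI)
    fix i assume i: "i \<in> {1..N}"
    show "0 \<le> K i j" if "j \<in> {1..N}" for j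
      using \<pi>_nonneg q_nonneg i that by (auto simp: K_def)
    show "(\<Sum>j\<in>{1..N}. K i j) = 1"
    proof (cases "\<pi> i = 0")
      case False
      then have "(\<Sum>j\<in>{1..N}. K i j) = (\<Sum>j\<in>{1..N}. q i j) / \<pi> i"
        by (simp add: K_def sum_divide_distrib)
      then show ?thesis
        using False by (simp add: \<pi>_def)
    qed (simp add: K_def \<pi>_sum)
  qed
  obtain \<nu> where fs: "full_shift_prob \<nu> N"
    and law: "\<And>n w. w \<in> words {1..N} (Suc n) \<Longrightarrow>
      measure \<nu> (prefix_word (Suc n) -` {w} \<inter> space \<nu>) = \<pi> (w ! 0) * path_weight K w"
    using markov_measure_exists[OF \<pi>_nonneg \<pi>_sum K_stoch] by blast
  have "(\<Sum>i\<in>{1..N}. \<pi> i * K i j) = \<pi> j" if "j \<in> {1..N}" for j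
  proof -
    have "(\<Sum>i\<in>{1..N}. \<pi> i * K i j) = (\<Sum>i\<in>{1..N}. q i j)"
      using that by (intro sum.cong refl \<pi>K)
    then show ?thesis
      by (simp only: \<pi>_def q_stat[OF that])
  qed
  then have inv: "shift_invariant_prob \<nu> N"
    by (intro markov_shift_invariant[where \<pi> = \<pi> and K = K] fs law)
  interpret shift_invariant_prob \<nu> N by fact
  have int_pair: "(\<integral>x. g (x 0) (x 1) \<partial>\<nu>) = (\<Sum>i\<in>{1..N}. \<Sum>j\<in>{1..N}. q i j * g i j)" for g :: "nat \<Rightarrow> nat \<Rightarrow> real"
  proof -
    have "(\<integral>x. g (x 0) (x 1) \<partial>\<nu>) = (\<integral>x. (\<lambda>w. g (w ! 0) (w ! 1)) (prefix_word (Suc (Suc 0)) x) \<partial>\<nu>)"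
      by (simp add: One_nat_def)
    also have "\<dots> = (\<Sum>w\<in>words {1..N} (Suc (Suc 0)). \<pi> (w ! 0) * path_weight K w * g (w ! 0) (w ! 1))"
      by (subst integral_finite_valued[OF measurable_prefix_word]) (simp_all add: law)
    also have "\<dots> = (\<Sum>i\<in>{1..N}. \<Sum>j\<in>{1..N}. \<pi> i * K i j * g i j)"
      unfolding sum_words_Suc[of _ _ "Suc 0"] sum_words_1 by (simp add: path_weight_def One_nat_def)
    also have "\<dots> = (\<Sum>i\<in>{1..N}. \<Sum>j\<in>{1..N}. q i j * g i j)"
      by (intro sum.cong refl) (simp only: \<pi>K)
    finally show ?thesis .
  qed
  have pair_int: "integrable \<nu> (\<lambda>x. g (x 0) (x 1))" for g :: "nat \<Rightarrow> nat \<Rightarrow> real"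
    using integrable_finite_valued[OF measurable_prefix_word[of "Suc (Suc 0)"], of "\<lambda>w. g (w ! 0) (w ! 1)"]
    by (simp add: One_nat_def)
  have "AE x in \<nu>. B (x 0) (x 1) = 1"
  proof -
    let ?bad = "{x \<in> space \<nu>. prefix_word (Suc (Suc 0)) x \<in> {w. B (w ! 0) (w ! 1) \<noteq> 1}}"
    have "prob ?bad = 0"
      unfolding prob_prefix_event
    proof (rule sum.neutral, rule ballI)
      fix w assume w: "w \<in> {w. B (w ! 0) (w ! 1) \<noteq> 1} \<inter> words {1..N} (Suc (Suc 0))"
      then have w01: "w ! 0 \<in> {1..N}" "w ! 1 \<in> {1..N}"
        by (auto intro!: nth_words simp del: atLeastAtMost_iff simp: One_nat_def)
      have "prob (prefix_word (Suc (Suc 0)) -` {w} \<inter> space \<nu>) = \<pi> (w ! 0) * K (w ! 0) (w ! 1)"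
      proof -
        have "length w = Suc (Suc 0)"
          using w length_words by blast
        then have "path_weight K w = K (w ! 0) (w ! 1)"
          by (simp add: path_weight_def One_nat_def)
        then show ?thesis
          using w law[of w "Suc 0"] by simp
      qed
      also have "\<dots> = q (w ! 0) (w ! 1)"
        by (rule \<pi>K[OF w01])
      also have "\<dots> = 0"
      proof (rule antisym)
        show "q (w ! 0) (w ! 1) \<le> 0"
          using w q_supp[OF w01] by (intro leI) blast
      qed (rule q_nonneg[OF w01])
      finally show "prob (prefix_word (Suc (Suc 0)) -` {w} \<inter> space \<nu>) = 0" .
    qed
    then have "AE x in \<nu>. x \<notin> ?bad"
      using prob_eq_0[OF prefix_event] by blast
    then show ?thesis
      using AE_space by eventually_elim (auto simp: One_nat_def)
  qed
  \<comment> \<open>Invariance carries the statement from the first edge to edge \<open>i\<close>;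
    countably many null sets are then united.\<close>
  then have "AE x in \<nu>. B (x i) (x (Suc i)) = 1" for i
    using AE_iterate[of "\<lambda>x. B (x 0) (x 1) = 1" i] by (simp add: funpow_shift One_nat_def)
  then have "AE x in \<nu>. \<forall>i. B (x i) (x (Suc i)) = 1"
    by (simp add: AE_all_countable)
  then have Y_AE: "AE x in \<nu>. x \<in> Y"
    using AE_space by eventually_elim (simp add: shift_space_def space_nu)
  have "Y \<in> sets \<nu>"
    by (rule sets_shift_space)
  then have "emeasure \<nu> Y = 1"
    using prob_eq_1[of Y] Y_AE by (simp add: emeasure_eq_measure)
  then have \<nu>_in: "\<nu> \<in> invariant_measures_on N Y"
    using inv by (simp add: shift_invariant_prob_iff)
  define h where "h = (\<integral>x. - ln (K (x 0) (x 1)) \<partial>\<nu>)"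
  define h0 where "h0 = (\<integral>x. - ln (\<pi> (x 0)) \<partial>\<nu>)"
  have int0: "integrable \<nu> (\<lambda>x. - ln (\<pi> (x 0)))" and int1: "integrable \<nu> (\<lambda>x. - ln (K (x 0) (x 1)))"
    using pair_int[of "\<lambda>a b. - ln (\<pi> a)"] pair_int[of "\<lambda>a b. - ln (K a b)"] by auto
  \<comment> \<open>The entropy of \<open>n + 1\<close> letters is exactly affine in
    \<open>n\<close>: the logarithm of the word probability splits into an initial term and
    \<open>n\<close> edge terms, which have equal means by invariance.\<close>
  have ent: "rv_entropy \<nu> (prefix_word (Suc n)) (words {1..N} (Suc n)) = h0 + real n * h" for n
  proof -
    let ?p = "\<lambda>w. \<pi> (w ! 0) * path_weight K w"
    have p_eq: "?p (prefix_word (Suc n) x) = \<pi> (x 0) * (\<Prod>i<n. K (x i) (x (Suc i)))" for x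
      by (simp add: path_weight_prefix_word)
    have pos: "AE x in \<nu>. 0 < ?p (prefix_word (Suc n) x)"
    proof -
      have "AE x in \<nu>. 0 < prob (prefix_word (Suc n) -` {prefix_word (Suc n) x} \<inter> space \<nu>)"
        by (rule AE_prob_fibre_pos[OF measurable_prefix_word]) simp
      moreover have "prefix_word (Suc n) x \<in> words {1..N} (Suc n)" if "x \<in> space \<nu>" for x
        using measurable_space[OF measurable_prefix_word that] by simp
      ultimately show ?thesis
        using AE_space by (auto elim!: eventually_mono simp: law)
    qed
    have "rv_entropy \<nu> (prefix_word (Suc n)) (words {1..N} (Suc n)) = (\<integral>x. - ln (?p (prefix_word (Suc n) x)) \<partial>\<nu>)"
      by (subst integral_finite_valued[OF measurable_prefix_word[of "Suc n"], where g = "\<lambda>w. - ln (?p w)"])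
        (simp_all add: rv_entropy_def law)
    also have "\<dots> = (\<integral>x. - ln (\<pi> (x 0)) + (\<Sum>i<n. - ln (K ((shift ^^ i) x 0) ((shift ^^ i) x 1))) \<partial>\<nu>)"
    proof (rule integral_cong_AE)
      show "(\<lambda>x. - ln (?p (prefix_word (Suc n) x))) \<in> borel_measurable \<nu>"
        by (rule borel_measurable_integrable, rule integrable_finite_valued[OF measurable_prefix_word[of "Suc n"]]) simp
      show "(\<lambda>x. - ln (\<pi> (x 0)) + (\<Sum>i<n. - ln (K ((shift ^^ i) x 0) ((shift ^^ i) x 1)))) \<in> borel_measurable \<nu>"
        by (intro borel_measurable_integrable Bochner_Integration.integrable_add Bochner_Integration.integrable_sum
            integrable_iterate[OF int1] int0)
      show "AE x in \<nu>. - ln (?p (prefix_word (Suc n) x))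
          = - ln (\<pi> (x 0)) + (\<Sum>i<n. - ln (K ((shift ^^ i) x 0) ((shift ^^ i) x 1)))"
        using pos
      proof eventually_elim
        case (elim x)
        then have pos': "0 < \<pi> (x 0) * (\<Prod>i<n. K (x i) (x (Suc i)))"
          by (simp only: p_eq)
        then have "\<pi> (x 0) \<noteq> 0" and ne: "(\<Prod>i<n. K (x i) (x (Suc i))) \<noteq> 0"
          by (metis less_irrefl mult_zero_left, metis less_irrefl mult_zero_right)
        moreover have "ln (\<Prod>i<n. K (x i) (x (Suc i))) = (\<Sum>i<n. ln (K (x i) (x (Suc i))))"
          using ne by (subst ln_prod) auto
        ultimately show ?case
          unfolding p_eq
          by (subst ln_mult) (simp_all add: funpow_shift One_nat_def sum_negf)
      qed
    qed
    also have "\<dots> = h0 + (\<Sum>i<n. \<integral>x. - ln (K ((shift ^^ i) x 0) ((shift ^^ i) x 1)) \<partial>\<nu>)"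
      by (subst Bochner_Integration.integral_add[OF int0 Bochner_Integration.integrable_sum[OF integrable_iterate[OF int1]]],
          subst Bochner_Integration.integral_sum[OF integrable_iterate[OF int1]], simp only: h0_def)
    also have "\<dots> = h0 + real n * h"
      by (simp only: integral_iterate[OF borel_measurable_integrable[OF int1]] h_def sum_constant card_lessThan)
    finally show ?thesis .
  qed
  have "(\<lambda>n. partition_entropy \<nu> (iterated_join \<nu> shift (letter ` {1..N}) (Suc n)) / real (Suc n)) \<longlonglongrightarrow> h"
  proof -
    have "(\<lambda>n. h + (h0 - h) / real (Suc n)) \<longlonglongrightarrow> h + 0"
      by (intro tendsto_intros LIMSEQ_Suc[OF lim_const_over_n])
    moreover have "(h0 + real n * h) / real (Suc n) = h + (h0 - h) / real (Suc n)" for n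
      by (simp add: field_simps)
    ultimately show ?thesis
      unfolding entropy_letters ent by simp
  qed
  then have "(\<lambda>n. partition_entropy \<nu> (iterated_join \<nu> shift (letter ` {1..N}) n) / real n) \<longlonglongrightarrow> h"
    by (rule LIMSEQ_imp_Suc)
  then have "lim (\<lambda>n. partition_entropy \<nu> (iterated_join \<nu> shift (letter ` {1..N}) n) / real n) = h"
    by (rule limI)
  \<comment> \<open>The letter partition is one competitor in the supremum defining
    \<open>ks_entropy\<close>.\<close>
  then have "ereal h \<le> ks_entropy \<nu> shift"
    unfolding ks_entropy_def by (intro SUP_upper2[OF letter_partition]) simp
  moreover have "edge_pressure N P q = h + (\<integral>x. \<phi> x \<partial>\<nu>)"
  proof -
    have "h + (\<integral>x. \<phi> x \<partial>\<nu>) = (\<Sum>i\<in>{1..N}. \<Sum>j\<in>{1..N}. q i j * (ln (P i j) - ln (K i j)))"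
      unfolding h_def int_pair[of "\<lambda>i j. - ln (K i j)"] int_pair[of "\<lambda>i j. ln (P i j)"]
      by (simp add: sum.distrib[symmetric] right_diff_distrib)
    also have "\<dots> = (\<Sum>i\<in>{1..N}. \<Sum>j\<in>{1..N}. q i j * (ln (P i j) - ln (q i j / (\<Sum>k\<in>{1..N}. q i k))))"
    proof (intro sum.cong refl)
      fix i j assume ij: "i \<in> {1..N}" "j \<in> {1..N}"
      \<comment> \<open>Where \<open>\<pi> i = 0\<close>, also \<open>q i j = 0\<close>, so the
        replacement row in \<open>K\<close> leaves no trace.\<close>
      show "q i j * (ln (P i j) - ln (K i j)) = q i j * (ln (P i j) - ln (q i j / (\<Sum>k\<in>{1..N}. q i k)))"
        using q_le[OF ij] q_nonneg[OF ij] by (cases "\<pi> i = 0") (auto simp: K_def \<pi>_def[symmetric])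
    qed
    also have "\<dots> = edge_pressure N P q"
      by (intro edge_pressure_eq[symmetric] q_nonneg)
    finally show ?thesis by simp
  qed
  ultimately have "ereal (edge_pressure N P q) \<le> ks_entropy \<nu> shift + ereal (\<integral>x. \<phi> x \<partial>\<nu>)"
    using add_right_mono[of "ereal h" "ks_entropy \<nu> shift" "ereal (\<integral>x. \<phi> x \<partial>\<nu>)"] by simp
  also have "\<dots> \<le> pressure N Y \<phi>"
    unfolding pressure_def by (rule SUP_upper[OF \<nu>_in])
  finally show ?thesis .
qed

end

section \<open>Growth of the partition function\<close>

text \<open>Only the limit \<open>0\<close> is delicate. There \<open>ln t \<le> t - 1\<close> at
  \<open>t = 1 / sqrt y\<close> gives \<open>\<bar>y * ln y\<bar> \<le> 2 * sqrt y\<close> for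
  \<open>0 < y < 1\<close>.\<close>

lemma tendsto_mult_ln_self:
  fixes f :: "'a \<Rightarrow> real"
  assumes f: "(f \<longlongrightarrow> a) F" and nn: "\<And>x. 0 \<le> f x" and a: "0 \<le> a"
  shows "((\<lambda>x. f x * ln (f x)) \<longlongrightarrow> a * ln a) F"
proof (cases "a = 0")
  case False
  then show ?thesis
    by (intro tendsto_intros f)
next
  case True
  have bound: "norm (y * ln y) \<le> 2 * sqrt y" if "0 \<le> y" "y < 1" for y :: real
  proof (cases "y = 0")
    case False
    then have y: "0 < sqrt y"
      using that by simp
    have "- ln y = 2 * ln (1 / sqrt y)"
      using False that by (simp add: ln_sqrt ln_div)
    also have "\<dots> \<le> 2 * (1 / sqrt y)"
      using ln_le_minus_one[of "1 / sqrt y"] y by simp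
    finally have "y * - ln y \<le> y * (2 * (1 / sqrt y))"
      using that by (intro mult_left_mono)
    also have "\<dots> = 2 * (y / sqrt y)"
      by simp
    also have "\<dots> = 2 * sqrt y"
      by (simp only: real_div_sqrt[OF that(1)])
    finally show ?thesis
      using that False by (simp add: abs_mult abs_of_nonpos)
  qed simp
  have "\<forall>\<^sub>F x in F. f x < 1"
    using f True by (intro order_tendstoD) auto
  then have "\<forall>\<^sub>F x in F. norm (f x * ln (f x)) \<le> 2 * sqrt (f x)"
    by eventually_elim (intro bound nn)
  moreover have "((\<lambda>x. 2 * sqrt (f x)) \<longlongrightarrow> 2 * sqrt a) F"
    by (intro tendsto_intros f)
  then have "((\<lambda>x. 2 * sqrt (f x)) \<longlongrightarrow> 0) F"
    by (simp only: True real_sqrt_zero mult_zero_right)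
  ultimately have "((\<lambda>x. f x * ln (f x)) \<longlongrightarrow> 0) F"
    by (rule Lim_null_comparison)
  then show ?thesis
    by (simp only: True mult_zero_left)
qed

text \<open>Bolzano-Weierstrass for one coordinate after another; thinning a sequence preserves the
  convergence already obtained.\<close>

lemma finite_family_convergent_subseq:
  fixes f :: "nat \<Rightarrow> 'a \<Rightarrow> real"
  assumes "finite S" and f: "\<And>n s. f n s \<in> {0..1}"
  shows "\<exists>r::nat \<Rightarrow> nat. strict_mono r \<and> (\<forall>s\<in>S. convergent (\<lambda>n. f (r n) s))"
  using \<open>finite S\<close>
proof induction
  case empty
  then show ?case
    by (intro exI[of _ id]) (auto simp: strict_mono_def)
next
  case (insert s S)
  then obtain r :: "nat \<Rightarrow> nat" where r: "strict_mono r" "\<forall>s\<in>S. convergent (\<lambda>n. f (r n) s)"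
    by blast
  obtain l and r' :: "nat \<Rightarrow> nat" where r': "strict_mono r'" "((\<lambda>n. f (r n) s) \<circ> r') \<longlonglongrightarrow> l"
    using compact_Icc[of "0::real" 1, unfolded compact_eq_seq_compact_metric seq_compact_def] f by metis
  have "strict_mono (r \<circ> r')"
    using r(1) r'(1) by (rule strict_mono_o)
  moreover have "convergent (\<lambda>n. f ((r \<circ> r') n) t)" if "t \<in> insert s S" for t
  proof (cases "t = s")
    case True
    then show ?thesis
      using r'(2) by (auto simp: convergent_def comp_def)
  next
    case False
    then show ?thesis
      using that r(2) convergent_subseq_convergent[OF _ r'(1), of "\<lambda>n. f (r n) t"] by (simp add: comp_def)
  qed
  ultimately show ?case
    by blast
qed

context weighted_shift
begin

section \<open>The weighted random word and its mean edge law\<close>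

definition word_prob :: "nat \<Rightarrow> nat list \<Rightarrow> real" where
  "word_prob n w = path_weight W w / Z n"

definition mean_edge :: "nat \<Rightarrow> nat \<Rightarrow> nat \<Rightarrow> real" where
  "mean_edge n i j = (\<Sum>t<n. \<Sum>w\<in>words {1..N} (Suc n). word_prob n w * of_bool (w ! t = i \<and> w ! Suc t = j)) / real n"

context
  assumes Z_all_pos: "\<And>n. 0 < Z n"
begin

lemma word_prob_nonneg: "w \<in> words {1..N} (Suc n) \<Longrightarrow> 0 \<le> word_prob n w"
  by (simp add: word_prob_def weight_nonneg Z_nonneg)

lemma sum_word_prob: "(\<Sum>w\<in>words {1..N} (Suc n). word_prob n w) = 1"
  using Z_all_pos[of n] by (simp add: word_prob_def sum_divide_distrib[symmetric] partition_function_def)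

lemma mean_edge_nonneg: "0 \<le> mean_edge n i j"
  unfolding mean_edge_def by (intro divide_nonneg_nonneg sum_nonneg mult_nonneg_nonneg word_prob_nonneg) auto

lemma mean_edge_le_1: "mean_edge n i j \<le> 1"
proof (cases "n = 0")
  case False
  have "mean_edge n i j \<le> (\<Sum>t<n. \<Sum>w\<in>words {1..N} (Suc n). word_prob n w) / real n"
    unfolding mean_edge_def by (intro divide_right_mono sum_mono) (auto simp: word_prob_nonneg)
  then show ?thesis
    using False by (simp add: sum_word_prob)
qed (simp add: mean_edge_def)

text \<open>Passes from the mean edge law to time averages along a random word. With
  \<open>g\<close> constant, a difference of indicators, or the logarithm of a matrix, it gives the
  total mass, the approximate stationarity and the terms of Gibbs' inequality.\<close>

lemma sum_mean_edge:
  fixes g :: "nat \<Rightarrow> nat \<Rightarrow> real"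
  shows "(\<Sum>i\<in>{1..N}. \<Sum>j\<in>{1..N}. mean_edge n i j * g i j)
    = (\<Sum>t<n. \<Sum>w\<in>words {1..N} (Suc n). word_prob n w * g (w ! t) (w ! Suc t)) / real n"
proof -
  have inner: "(\<Sum>i\<in>{1..N}. \<Sum>j\<in>{1..N}. of_bool (a = i \<and> b = j) * g i j) = g a b"
    if "a \<in> {1..N}" "b \<in> {1..N}" for a b
  proof -
    have "(\<Sum>i\<in>{1..N}. \<Sum>j\<in>{1..N}. of_bool (a = i \<and> b = j) * g i j)
        = (\<Sum>i\<in>{1..N}. \<Sum>j\<in>{1..N}. if a = i then if b = j then g i j else 0 else 0)"
      by (intro sum.cong refl) auto
    also have "\<dots> = (\<Sum>i\<in>{1..N}. if a = i then g i b else 0)"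
      using that by (intro sum.cong refl) (simp add: sum.delta')
    also have "\<dots> = g a b"
      using that by (simp add: sum.delta')
    finally show ?thesis .
  qed
  have "(\<Sum>i\<in>{1..N}. \<Sum>j\<in>{1..N}. mean_edge n i j * g i j)
      = (\<Sum>i\<in>{1..N}. \<Sum>j\<in>{1..N}. \<Sum>t<n. \<Sum>w\<in>words {1..N} (Suc n).
          word_prob n w * (of_bool (w ! t = i \<and> w ! Suc t = j) * g i j)) / real n"
  proof -
    have "mean_edge n i j * g i j = (\<Sum>t<n. \<Sum>w\<in>words {1..N} (Suc n).
          word_prob n w * (of_bool (w ! t = i \<and> w ! Suc t = j) * g i j)) / real n" for i j
      by (simp only: mean_edge_def times_divide_eq_left sum_distrib_right mult.assoc)
    then show ?thesis
      by (simp only: sum_divide_distrib[symmetric])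
  qed
  also have "\<dots> = (\<Sum>t<n. \<Sum>w\<in>words {1..N} (Suc n). \<Sum>i\<in>{1..N}. \<Sum>j\<in>{1..N}.
          word_prob n w * (of_bool (w ! t = i \<and> w ! Suc t = j) * g i j)) / real n"
    unfolding sum.cartesian_product
    by (intro arg_cong2[where f = "(/)"] refl
        sum.reindex_bij_witness[where i = "\<lambda>(t, w, i, j). (i, j, t, w)" and j = "\<lambda>(i, j, t, w). (t, w, i, j)"]) auto
  also have "\<dots> = (\<Sum>t<n. \<Sum>w\<in>words {1..N} (Suc n). word_prob n w * g (w ! t) (w ! Suc t)) / real n"
    by (intro arg_cong2[where f = "(/)"] sum.cong refl)
      (simp only: sum_distrib_left[symmetric] inner nth_words lessThan_iff Suc_less_eq less_SucI)
  finally show ?thesis .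
qed

lemma sum_mean_edge_1: "1 \<le> n \<Longrightarrow> (\<Sum>i\<in>{1..N}. \<Sum>j\<in>{1..N}. mean_edge n i j) = 1"
  using sum_mean_edge[of n "\<lambda>_ _. 1"] by (simp add: sum_word_prob)

text \<open>Along each word the difference of departures from and arrivals at \<open>i\<close>
  telescopes to a comparison of the first with the last letter, which is at most \<open>1\<close> in
  absolute value.\<close>

lemma mean_edge_stationary:
  assumes i: "i \<in> {1..N}"
  shows "\<bar>(\<Sum>j\<in>{1..N}. mean_edge n i j) - (\<Sum>j\<in>{1..N}. mean_edge n j i)\<bar> \<le> 1 / real n"
proof -
  let ?g = "\<lambda>a b. of_bool (a = i) - of_bool (b = i) :: real"
  have "(\<Sum>j\<in>{1..N}. mean_edge n i j) - (\<Sum>j\<in>{1..N}. mean_edge n j i)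
      = (\<Sum>a\<in>{1..N}. \<Sum>b\<in>{1..N}. mean_edge n a b * of_bool (a = i)) - (\<Sum>a\<in>{1..N}. \<Sum>b\<in>{1..N}. mean_edge n a b * of_bool (b = i))"
  proof -
    have "(\<Sum>a\<in>{1..N}. \<Sum>b\<in>{1..N}. mean_edge n a b * of_bool (a = i)) = (\<Sum>a\<in>{1..N}. if a = i then \<Sum>b\<in>{1..N}. mean_edge n a b else 0)"
      by (intro sum.cong refl) auto
    moreover have "(\<Sum>b\<in>{1..N}. mean_edge n a b * of_bool (b = i)) = (\<Sum>b\<in>{1..N}. if b = i then mean_edge n a b else 0)" for a
      by (intro sum.cong refl) auto
    ultimately show ?thesis
      using i by simp
  qed
  also have "\<dots> = (\<Sum>a\<in>{1..N}. \<Sum>b\<in>{1..N}. mean_edge n a b * ?g a b)"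
    by (simp only: sum_subtractf right_diff_distrib)
  also have "\<dots> = (\<Sum>w\<in>words {1..N} (Suc n). word_prob n w * (\<Sum>t<n. ?g (w ! t) (w ! Suc t))) / real n"
    unfolding sum_mean_edge by (subst sum.swap) (simp only: sum_distrib_left)
  also have "\<dots> = (\<Sum>w\<in>words {1..N} (Suc n). word_prob n w * ?g (w ! 0) (w ! n)) / real n"
  proof -
    have "(\<Sum>t<m. ?g (f t) (f (Suc t))) = ?g (f 0) (f m)" for f :: "nat \<Rightarrow> nat" and m
      by (induction m) auto
    then show ?thesis
      by (simp only:)
  qed
  also have "\<bar>\<dots>\<bar> \<le> (\<Sum>w\<in>words {1..N} (Suc n). word_prob n w) / real n"
    unfolding abs_divide abs_of_nat
  proof (rule divide_right_mono)
    have "\<bar>\<Sum>w\<in>words {1..N} (Suc n). word_prob n w * ?g (w ! 0) (w ! n)\<bar>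
        \<le> (\<Sum>w\<in>words {1..N} (Suc n). \<bar>word_prob n w * ?g (w ! 0) (w ! n)\<bar>)"
      by (rule sum_abs)
    also have "\<dots> \<le> (\<Sum>w\<in>words {1..N} (Suc n). word_prob n w)"
    proof (intro sum_mono)
      fix w assume "w \<in> words {1..N} (Suc n)"
      then show "\<bar>word_prob n w * ?g (w ! 0) (w ! n)\<bar> \<le> word_prob n w"
        using word_prob_nonneg[of w n] by (auto simp: abs_mult)
    qed
    finally show "\<bar>\<Sum>w\<in>words {1..N} (Suc n). word_prob n w * ?g (w ! 0) (w ! n)\<bar> \<le> (\<Sum>w\<in>words {1..N} (Suc n). word_prob n w)" .
  qed simp
  finally show ?thesis
    by (simp only: sum_word_prob)
qed

lemma weight_pos_edge:
  assumes "w \<in> words {1..N} (Suc n)" and "0 < path_weight W w" and "t < n"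
  shows "0 < W (w ! t) (w ! Suc t)"
proof -
  have "path_weight W w = (\<Prod>t<n. W (w ! t) (w ! Suc t))"
    by (simp add: path_weight_def length_words[OF assms(1)])
  moreover have "(\<Prod>t<n. W (w ! t) (w ! Suc t)) = 0" if "W (w ! t) (w ! Suc t) = 0"
    using assms(3) that by (intro prod_zero) auto
  ultimately have "W (w ! t) (w ! Suc t) \<noteq> 0"
    by (metis assms(2) less_irrefl)
  moreover have "0 \<le> W (w ! t) (w ! Suc t)"
    using assms(3) by (intro W_nonneg nth_words[OF assms(1)]) auto
  ultimately show ?thesis
    by simp
qed

lemma mean_edge_supp:
  assumes ij: "i \<in> {1..N}" "j \<in> {1..N}" and B: "B i j \<noteq> 1"
  shows "mean_edge n i j = 0"
proof -
  have zero: "word_prob n w * of_bool (w ! t = i \<and> w ! Suc t = j) = 0" if "t < n" "w \<in> words {1..N} (Suc n)" for t w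
  proof (rule ccontr)
    assume ne: "\<not> ?thesis"
    then have "word_prob n w \<noteq> 0" "w ! t = i" "w ! Suc t = j"
      by auto
    then have "0 < path_weight W w"
      using weight_nonneg[OF that(2)] by (auto simp: word_prob_def)
    then have "0 < W i j"
      using weight_pos_edge[OF that(2) _ that(1)] \<open>w ! t = i\<close> \<open>w ! Suc t = j\<close> by simp
    then show False
      using B W_pos_iff[OF ij] by simp
  qed
  have "(\<Sum>t<n. \<Sum>w\<in>words {1..N} (Suc n). word_prob n w * of_bool (w ! t = i \<and> w ! Suc t = j)) = 0"
    by (intro sum.neutral ballI zero) simp_all
  then show ?thesis
    by (simp only: mean_edge_def div_0)
qed

text \<open>Gibbs' inequality for the random word against the chain that starts uniformly and moves
  by the conditional law \<open>K\<close> of the mean edge. The uniform start costs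
  \<open>ln (real N)\<close>; both logarithms are sums over edges, hence \<open>real n\<close> times
  averages under \<open>mean_edge n\<close>.\<close>

lemma ln_Z_le_edge_pressure:
  assumes n: "1 \<le> n" and N: "1 \<le> N"
  shows "ln (Z n) \<le> ln (real N) + real n * edge_pressure N P (mean_edge n)"
proof -
  let ?I = "words {1..N} (Suc n)"
  \<comment> \<open>A row of mass zero becomes the zero row by division by \<open>0\<close>. Row
    sums are thus at most \<open>1\<close>, which suffices for a trial sub-probability.\<close>
  define K where "K i j = mean_edge n i j / (\<Sum>k\<in>{1..N}. mean_edge n i k)" for i j
  have K_nonneg: "0 \<le> K i j" for i j
    unfolding K_def by (intro divide_nonneg_nonneg sum_nonneg mean_edge_nonneg)
  have K_sum: "(\<Sum>j\<in>{1..N}. K i j) \<le> 1" for i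
    by (simp add: K_def sum_divide_distrib[symmetric])
  have "partition_function N K m \<le> real N" for m
  proof (induction m)
    case (Suc m)
    have "partition_function N K (Suc m) \<le> partition_function N K m"
      by (intro partition_function_Suc_le K_nonneg K_sum)
    then show ?case
      using Suc by linarith
  qed simp
  then have K_part: "(\<Sum>w\<in>?I. path_weight K w) \<le> real N"
    by (simp add: partition_function_def)
  \<comment> \<open>A word of positive probability contributes itself to the mean frequency of each
    of its edges, so \<open>K\<close> is positive along the word.\<close>
  have edge: "0 < P (w ! t) (w ! Suc t)" "0 < K (w ! t) (w ! Suc t)" "W (w ! t) (w ! Suc t) = P (w ! t) (w ! Suc t)"
    if w: "w \<in> ?I" and pos: "0 < word_prob n w" and t: "t < n" for w t
  proof -
    have wt: "w ! t \<in> {1..N}" "w ! Suc t \<in> {1..N}"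
      using nth_words[OF w] t by auto
    have "0 < path_weight W w"
      using pos Z_all_pos[of n] by (simp add: word_prob_def zero_less_divide_iff)
    then have "0 < W (w ! t) (w ! Suc t)"
      using weight_pos_edge[OF w _ t] by simp
    then show "0 < P (w ! t) (w ! Suc t)" "W (w ! t) (w ! Suc t) = P (w ! t) (w ! Suc t)"
      by (auto simp: edge_matrix_def split: if_splits)
    have "word_prob n w = word_prob n w * of_bool (w ! t = w ! t \<and> w ! Suc t = w ! Suc t)"
      by simp
    also have "\<dots> \<le> (\<Sum>v\<in>?I. word_prob n v * of_bool (v ! t = w ! t \<and> v ! Suc t = w ! Suc t))"
      using w by (intro member_le_sum[where f = "\<lambda>v. word_prob n v * of_bool (v ! t = w ! t \<and> v ! Suc t = w ! Suc t)"])
        (auto simp: word_prob_nonneg)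
    also have "\<dots> \<le> (\<Sum>s<n. \<Sum>v\<in>?I. word_prob n v * of_bool (v ! s = w ! t \<and> v ! Suc s = w ! Suc t))"
      using t by (intro member_le_sum[where f = "\<lambda>s. \<Sum>v\<in>?I. word_prob n v * of_bool (v ! s = w ! t \<and> v ! Suc s = w ! Suc t)"])
        (auto intro!: sum_nonneg simp: word_prob_nonneg)
    finally have q_pos: "0 < mean_edge n (w ! t) (w ! Suc t)"
      using pos n by (simp add: mean_edge_def)
    moreover have "mean_edge n (w ! t) (w ! Suc t) \<le> (\<Sum>k\<in>{1..N}. mean_edge n (w ! t) k)"
      using wt by (intro member_le_sum mean_edge_nonneg) auto
    ultimately show "0 < K (w ! t) (w ! Suc t)"
      by (simp add: K_def)
  qed
  have "(\<Sum>w\<in>?I. word_prob n w * ln (path_weight K w / real N)) \<le> (\<Sum>w\<in>?I. word_prob n w * ln (word_prob n w))"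
  proof (rule gibbs_inequality)
    show "0 \<le> word_prob n w" if "w \<in> ?I" for w
      using that by (rule word_prob_nonneg)
    show "0 \<le> path_weight K w / real N" if "w \<in> ?I" for w
      using that by (intro divide_nonneg_nonneg path_weight_nonneg[OF K_nonneg]) auto
    show "0 < path_weight K w / real N" if "w \<in> ?I" "0 < word_prob n w" for w
      unfolding path_weight_def length_words[OF that(1)] using N edge(2)[OF that]
      by (intro divide_pos_pos prod_pos) auto
    show "(\<Sum>w\<in>?I. path_weight K w / real N) \<le> (\<Sum>w\<in>?I. word_prob n w)"
      using K_part N by (simp add: sum_word_prob sum_divide_distrib[symmetric])
  qed
  moreover have "(\<Sum>w\<in>?I. word_prob n w * ln (path_weight K w / real N))
      = real n * (\<Sum>i\<in>{1..N}. \<Sum>j\<in>{1..N}. mean_edge n i j * ln (K i j)) - ln (real N)"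
  proof -
    have "(\<Sum>w\<in>?I. word_prob n w * ln (path_weight K w / real N))
        = (\<Sum>w\<in>?I. word_prob n w * (\<Sum>t<n. ln (K (w ! t) (w ! Suc t))) - word_prob n w * ln (real N))"
    proof (intro sum.cong refl)
      fix w assume w: "w \<in> ?I"
      show "word_prob n w * ln (path_weight K w / real N)
          = word_prob n w * (\<Sum>t<n. ln (K (w ! t) (w ! Suc t))) - word_prob n w * ln (real N)"
      proof (cases "word_prob n w = 0")
        case False
        then have pos: "0 < word_prob n w"
          using word_prob_nonneg[OF w] by simp
        have "path_weight K w = (\<Prod>t<n. K (w ! t) (w ! Suc t))"
          by (simp add: path_weight_def length_words[OF w])
        moreover have "0 < (\<Prod>t<n. K (w ! t) (w ! Suc t))"
          using edge(2)[OF w pos] by (intro prod_pos) auto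
        moreover have "ln (\<Prod>t<n. K (w ! t) (w ! Suc t)) = (\<Sum>t<n. ln (K (w ! t) (w ! Suc t)))"
          using edge(2)[OF w pos] by (intro ln_prod) force+
        ultimately have "ln (path_weight K w / real N) = (\<Sum>t<n. ln (K (w ! t) (w ! Suc t))) - ln (real N)"
          using N by (metis ln_divide_pos less_le_trans of_nat_0_less_iff zero_less_one)
        then show ?thesis
          by (simp only: right_diff_distrib)
      qed simp
    qed
    also have "\<dots> = (\<Sum>w\<in>?I. \<Sum>t<n. word_prob n w * ln (K (w ! t) (w ! Suc t))) - ln (real N)"
      by (simp add: sum_subtractf sum_distrib_left sum_distrib_right[symmetric] sum_word_prob)
    also have "(\<Sum>w\<in>?I. \<Sum>t<n. word_prob n w * ln (K (w ! t) (w ! Suc t)))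
        = real n * (\<Sum>i\<in>{1..N}. \<Sum>j\<in>{1..N}. mean_edge n i j * ln (K i j))"
      unfolding sum_mean_edge using n by (subst sum.swap) simp
    finally show ?thesis .
  qed
  moreover have "(\<Sum>w\<in>?I. word_prob n w * ln (word_prob n w))
      = real n * (\<Sum>i\<in>{1..N}. \<Sum>j\<in>{1..N}. mean_edge n i j * ln (P i j)) - ln (Z n)"
  proof -
    have "(\<Sum>w\<in>?I. word_prob n w * ln (word_prob n w))
        = (\<Sum>w\<in>?I. word_prob n w * (\<Sum>t<n. ln (P (w ! t) (w ! Suc t))) - word_prob n w * ln (Z n))"
    proof (intro sum.cong refl)
      fix w assume w: "w \<in> ?I"
      show "word_prob n w * ln (word_prob n w)
          = word_prob n w * (\<Sum>t<n. ln (P (w ! t) (w ! Suc t))) - word_prob n w * ln (Z n)"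
      proof (cases "word_prob n w = 0")
        case False
        then have pos: "0 < word_prob n w"
          using word_prob_nonneg[OF w] by simp
        have "path_weight W w = (\<Prod>t<n. P (w ! t) (w ! Suc t))"
          using edge(3)[OF w pos] by (simp add: path_weight_def length_words[OF w])
        moreover have "0 < (\<Prod>t<n. P (w ! t) (w ! Suc t))"
          using edge(1)[OF w pos] by (intro prod_pos) auto
        moreover have "ln (\<Prod>t<n. P (w ! t) (w ! Suc t)) = (\<Sum>t<n. ln (P (w ! t) (w ! Suc t)))"
          using edge(1)[OF w pos] by (intro ln_prod) force+
        ultimately have "ln (word_prob n w) = (\<Sum>t<n. ln (P (w ! t) (w ! Suc t))) - ln (Z n)"
          unfolding word_prob_def by (metis ln_divide_pos Z_all_pos)
        then show ?thesis
          by (simp only: right_diff_distrib)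
      qed simp
    qed
    also have "\<dots> = (\<Sum>w\<in>?I. \<Sum>t<n. word_prob n w * ln (P (w ! t) (w ! Suc t))) - ln (Z n)"
      by (simp add: sum_subtractf sum_distrib_left sum_distrib_right[symmetric] sum_word_prob)
    also have "(\<Sum>w\<in>?I. \<Sum>t<n. word_prob n w * ln (P (w ! t) (w ! Suc t)))
        = real n * (\<Sum>i\<in>{1..N}. \<Sum>j\<in>{1..N}. mean_edge n i j * ln (P i j))"
      unfolding sum_mean_edge using n by (subst sum.swap) simp
    finally show ?thesis .
  qed
  moreover have "edge_pressure N P (mean_edge n)
      = (\<Sum>i\<in>{1..N}. \<Sum>j\<in>{1..N}. mean_edge n i j * ln (P i j)) - (\<Sum>i\<in>{1..N}. \<Sum>j\<in>{1..N}. mean_edge n i j * ln (K i j))"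
    by (subst edge_pressure_eq[OF mean_edge_nonneg]) (simp only: K_def right_diff_distrib sum_subtractf)
  ultimately show ?thesis
    by (simp add: right_diff_distrib)
qed

text \<open>With \<open>q\<close> a limit point of the mean edge laws, the chain limsup \<le>
  \<open>edge_pressure N P q\<close> \<le> pressure \<le> liminf closes up.\<close>

lemma pressure_eq_lim:
  assumes N: "1 \<le> N"
  shows "\<exists>L. (\<lambda>n. ln (Z n) / real n) \<longlonglongrightarrow> L \<and> pressure N Y \<phi> = ereal L"
proof -
  let ?u = "\<lambda>n. ereal (ln (Z n) / real n)"
  \<comment> \<open>First a subsequence that attains the limsup, then a further one along which all
    mean edge frequencies converge.\<close>
  obtain r :: "nat \<Rightarrow> nat" where r: "strict_mono r" "(?u \<circ> r) \<longlonglongrightarrow> limsup ?u"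
    using limsup_subseq_lim[of ?u] by blast
  obtain s :: "nat \<Rightarrow> nat" where s: "strict_mono s"
    and conv: "\<forall>z\<in>{1..N} \<times> {1..N}. convergent (\<lambda>n. mean_edge (r (s n)) (fst z) (snd z))"
    using finite_family_convergent_subseq[of "{1..N} \<times> {1..N}" "\<lambda>n z. mean_edge (r n) (fst z) (snd z)"]
      mean_edge_nonneg mean_edge_le_1 by auto
  define q where "q i j = lim (\<lambda>n. mean_edge (r (s n)) i j)" for i j
  have q_lim: "(\<lambda>n. mean_edge (r (s n)) i j) \<longlonglongrightarrow> q i j" if "i \<in> {1..N}" "j \<in> {1..N}" for i j
    using conv that by (auto simp: q_def convergent_LIMSEQ_iff)
  have rs: "strict_mono (r \<circ> s)"
    using r(1) s by (rule strict_mono_o)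
  then have rs_top: "filterlim (\<lambda>n. r (s n)) sequentially sequentially"
    by (simp add: filterlim_subseq[of "r \<circ> s", unfolded comp_def] comp_def)
  have q_nonneg: "0 \<le> q i j" if "i \<in> {1..N}" "j \<in> {1..N}" for i j
    using q_lim[OF that] by (rule LIMSEQ_le_const) (auto simp: mean_edge_nonneg)
  have rs_ge: "\<forall>\<^sub>F n in sequentially. 1 \<le> r (s n)"
    using rs_top by (rule filterlim_at_top[THEN iffD1, rule_format])
  have q_sum: "(\<Sum>i\<in>{1..N}. \<Sum>j\<in>{1..N}. q i j) = 1"
  proof (rule LIMSEQ_unique)
    show "(\<lambda>n. \<Sum>i\<in>{1..N}. \<Sum>j\<in>{1..N}. mean_edge (r (s n)) i j) \<longlonglongrightarrow> (\<Sum>i\<in>{1..N}. \<Sum>j\<in>{1..N}. q i j)"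
      by (intro tendsto_sum q_lim)
    show "(\<lambda>n. \<Sum>i\<in>{1..N}. \<Sum>j\<in>{1..N}. mean_edge (r (s n)) i j) \<longlonglongrightarrow> 1"
      by (rule tendsto_eventually) (use rs_ge in eventually_elim, simp add: sum_mean_edge_1)
  qed
  have q_stat: "(\<Sum>j\<in>{1..N}. q i j) = (\<Sum>j\<in>{1..N}. q j i)" if i: "i \<in> {1..N}" for i
  proof -
    have "(\<lambda>n. (\<Sum>j\<in>{1..N}. mean_edge (r (s n)) i j) - (\<Sum>j\<in>{1..N}. mean_edge (r (s n)) j i))
        \<longlonglongrightarrow> (\<Sum>j\<in>{1..N}. q i j) - (\<Sum>j\<in>{1..N}. q j i)"
      using i by (intro tendsto_diff tendsto_sum q_lim)
    moreover have "(\<lambda>n. (\<Sum>j\<in>{1..N}. mean_edge (r (s n)) i j) - (\<Sum>j\<in>{1..N}. mean_edge (r (s n)) j i)) \<longlonglongrightarrow> 0"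
    proof (rule Lim_null_comparison)
      show "\<forall>\<^sub>F n in sequentially. norm ((\<Sum>j\<in>{1..N}. mean_edge (r (s n)) i j) - (\<Sum>j\<in>{1..N}. mean_edge (r (s n)) j i)) \<le> 1 / real (r (s n))"
        using mean_edge_stationary[OF i] by simp
      show "(\<lambda>n. 1 / real (r (s n))) \<longlonglongrightarrow> 0"
        using filterlim_compose[OF lim_const_over_n rs_top] .
    qed
    ultimately show ?thesis
      using LIMSEQ_unique by fastforce
  qed
  have q_supp: "B i j = 1" if ij: "i \<in> {1..N}" "j \<in> {1..N}" and pos: "0 < q i j" for i j
  proof (rule ccontr)
    assume "B i j \<noteq> 1"
    then have "(\<lambda>n. 0) \<longlonglongrightarrow> q i j"
      using q_lim[OF ij] mean_edge_supp[OF ij] by simp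
    then have "q i j = 0"
      by (rule LIMSEQ_unique) simp
    with pos show False by simp
  qed
  \<comment> \<open>Continuity of \<open>edge_pressure\<close> in the edge law, including the
    boundary where some frequencies tend to \<open>0\<close>.\<close>
  have "(\<lambda>n. edge_pressure N P (mean_edge (r (s n)))) \<longlonglongrightarrow> edge_pressure N P q"
    unfolding edge_pressure_def
    by (intro tendsto_add tendsto_diff tendsto_sum tendsto_mult_ln_self tendsto_mult q_lim tendsto_const
        mean_edge_nonneg sum_nonneg q_nonneg)
  then have "(\<lambda>n. ln (real N) / real (r (s n)) + edge_pressure N P (mean_edge (r (s n)))) \<longlonglongrightarrow> 0 + edge_pressure N P q"
    by (intro tendsto_add filterlim_compose[OF lim_const_over_n rs_top])
  then have upper: "(\<lambda>n. ereal (ln (real N) / real (r (s n)) + edge_pressure N P (mean_edge (r (s n))))) \<longlonglongrightarrow> ereal (edge_pressure N P q)"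
    by simp
  have "limsup ?u \<le> ereal (edge_pressure N P q)"
  proof (rule tendsto_le[OF _ upper])
    show "(\<lambda>n. ?u (r (s n))) \<longlonglongrightarrow> limsup ?u"
      using LIMSEQ_subseq_LIMSEQ[OF r(2) s] by (simp add: comp_def)
    show "\<forall>\<^sub>F n in sequentially. ?u (r (s n)) \<le> ereal (ln (real N) / real (r (s n)) + edge_pressure N P (mean_edge (r (s n))))"
      using rs_ge
    proof eventually_elim
      case (elim n)
      then have "ln (Z (r (s n))) / real (r (s n))
          \<le> (ln (real N) + real (r (s n)) * edge_pressure N P (mean_edge (r (s n)))) / real (r (s n))"
        using N by (intro divide_right_mono ln_Z_le_edge_pressure) auto
      then show ?case
        using elim by (simp add: add_divide_distrib)
    qed
  qed simp
  moreover have "ereal (edge_pressure N P q) \<le> pressure N Y \<phi>"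
    using q_nonneg q_sum q_stat q_supp by (rule edge_pressure_le_pressure)
  moreover have "liminf ?u \<le> limsup ?u"
    by (rule Liminf_le_Limsup) simp
  ultimately have eq: "liminf ?u = ereal (edge_pressure N P q)" "limsup ?u = ereal (edge_pressure N P q)"
    "pressure N Y \<phi> = ereal (edge_pressure N P q)"
    using pressure_le_liminf by (meson order_antisym order_trans)+
  then have "?u \<longlonglongrightarrow> ereal (edge_pressure N P q)"
    by (intro Liminf_eq_Limsup) simp_all
  then show ?thesis
    using eq(3) by auto
qed

end

end

section \<open>The escape rate\<close>

lemma mat_pow_nonneg:
  assumes "\<And>i j. i \<in> {1..N} \<Longrightarrow> j \<in> {1..N} \<Longrightarrow> 0 \<le> M i j" and "j \<in> {1..N}"
  shows "0 \<le> mat_pow N M n i j"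
  using assms(2) by (induction n arbitrary: j) (auto intro!: sum_nonneg mult_nonneg_nonneg assms(1))

text \<open>A positive entry of a power of \<open>A\<close> contains a path with positive steps, and
  each step is positive for \<open>P\<close> as well; the induction peels off the last step.\<close>

lemma mat_pow_pos_mono:
  assumes A: "\<And>i j. i \<in> {1..N} \<Longrightarrow> j \<in> {1..N} \<Longrightarrow> 0 \<le> A i j"
    and P: "\<And>i j. i \<in> {1..N} \<Longrightarrow> j \<in> {1..N} \<Longrightarrow> 0 \<le> P i j"
    and AP: "\<And>i j. i \<in> {1..N} \<Longrightarrow> j \<in> {1..N} \<Longrightarrow> 0 < A i j \<Longrightarrow> 0 < P i j"
    and "j \<in> {1..N}" and "0 < mat_pow N A n i j"
  shows "0 < mat_pow N P n i j"
  using assms(4,5)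
proof (induction n arbitrary: j)
  case (Suc n)
  have "\<exists>k\<in>{1..N}. mat_pow N A n i k * A k j \<noteq> 0"
  proof (rule ccontr)
    assume "\<not> ?thesis"
    then have "mat_pow N A (Suc n) i j = 0"
      by (simp add: sum.neutral)
    with Suc.prems show False by simp
  qed
  then obtain k where k: "k \<in> {1..N}" "mat_pow N A n i k \<noteq> 0" "A k j \<noteq> 0"
    by auto
  have "0 < mat_pow N A n i k"
    using mat_pow_nonneg[of N A k n i] A k by force
  then have "0 < mat_pow N P n i k * P k j"
    using Suc.IH[OF k(1)] AP[OF k(1) Suc.prems(1)] A[OF k(1) Suc.prems(1)] k(3) by simp
  also have "\<dots> \<le> mat_pow N P (Suc n) i j"
    unfolding mat_pow.simps using k(1) P Suc.prems(1)
    by (intro member_le_sum[where f = "\<lambda>k. mat_pow N P n i k * P k j"] mult_nonneg_nonneg mat_pow_nonneg) auto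
  finally show ?case .
qed simp

lemma stationary_mat_pow:
  assumes p: "stationary_vector N P p" and j: "j \<in> {1..N}"
  shows "(\<Sum>i\<in>{1..N}. p i * mat_pow N P n i j) = p j"
  using j
proof (induction n arbitrary: j)
  case 0
  have "(\<Sum>i\<in>{1..N}. p i * mat_pow N P 0 i j) = (\<Sum>i\<in>{1..N}. if i = j then p i else 0)"
    by (intro sum.cong refl) simp
  then show ?case
    using 0 by simp
next
  case (Suc n)
  have "(\<Sum>i\<in>{1..N}. p i * mat_pow N P (Suc n) i j) = (\<Sum>k\<in>{1..N}. (\<Sum>i\<in>{1..N}. p i * mat_pow N P n i k) * P k j)"
    unfolding mat_pow.simps sum_distrib_left sum_distrib_right by (subst sum.swap) (simp only: mult.assoc)
  also have "\<dots> = (\<Sum>k\<in>{1..N}. p k * P k j)"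
    by (intro sum.cong refl) (simp only: Suc.IH)
  also have "\<dots> = p j"
    using p Suc.prems by (simp add: stationary_vector_def)
  finally show ?case .
qed

text \<open>Some letter \<open>i\<close> carries mass, irreducibility provides a path from
  \<open>i\<close> to \<open>j\<close>, and stationarity under the corresponding power of
  \<open>P\<close> transports part of this mass to \<open>j\<close>.\<close>

lemma stationary_vector_pos:
  assumes A01: "zero_one_matrix N A" and A_irr: "irreducible_matrix N A" and P_stoch: "row_stochastic N P"
    and P_supp: "\<forall>i\<in>{1..N}. \<forall>j\<in>{1..N}. P i j > 0 \<longleftrightarrow> A i j = 1"
    and p: "stationary_vector N P p" and j: "j \<in> {1..N}"
  shows "0 < p j"
proof -
  have A: "0 \<le> A i j" "0 < A i j \<Longrightarrow> 0 < P i j" if "i \<in> {1..N}" "j \<in> {1..N}" for i j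
  proof -
    have "A i j = 0 \<or> A i j = 1"
      using A01 that by (auto simp: zero_one_matrix_def)
    moreover have "P i j > 0 \<longleftrightarrow> A i j = 1"
      using P_supp that by blast
    ultimately show "0 \<le> A i j" "0 < A i j \<Longrightarrow> 0 < P i j"
      by auto
  qed
  have P: "0 \<le> P i j" if "i \<in> {1..N}" "j \<in> {1..N}" for i j
    using P_stoch that by (auto simp: row_stochastic_def)
  have p_nonneg: "0 \<le> p i" if "i \<in> {1..N}" for i
    using p that by (auto simp: stationary_vector_def)
  have "\<exists>i\<in>{1..N}. p i \<noteq> 0"
  proof (rule ccontr)
    assume "\<not> ?thesis"
    then have "(\<Sum>i\<in>{1..N}. p i) = 0"
      by (intro sum.neutral) blast
    then show False
      using p by (simp add: stationary_vector_def)
  qed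
  then obtain i where i: "i \<in> {1..N}" "p i \<noteq> 0"
    by blast
  obtain n where "0 < mat_pow N A n i j"
    using A_irr i(1) j unfolding irreducible_matrix_def by blast
  then have "0 < mat_pow N P n i j"
    using mat_pow_pos_mono[of N A P j n i] A P j by blast
  then have "0 < p i * mat_pow N P n i j"
    using i p_nonneg[OF i(1)] by simp
  also have "\<dots> \<le> (\<Sum>i\<in>{1..N}. p i * mat_pow N P n i j)"
    using i(1) p_nonneg j P
    by (intro member_le_sum[where f = "\<lambda>i. p i * mat_pow N P n i j"] mult_nonneg_nonneg mat_pow_nonneg) auto
  also have "\<dots> = p j"
    by (rule stationary_mat_pow[OF p j])
  finally show ?thesis .
qed

section \<open>The measure of the survivor set\<close>

text \<open>Hole words have length two, so whether the orbit is in the hole at time \<open>i\<close>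
  depends only on the letters at \<open>i\<close> and \<open>i + 1\<close>. This pair is
  automatically allowed, since it occurs in \<open>x\<close>.\<close>

lemma survivor_eq:
  assumes G: "\<forall>w\<in>G. length w = 2"
  shows "survivor N A G m = {x \<in> shift_space N A. \<forall>i\<le>m. hole_matrix N A G (x i) (x (Suc i)) = 1}"
proof -
  have "(shift ^^ i) x \<notin> hole N A G \<longleftrightarrow> hole_matrix N A G (x i) (x (Suc i)) = 1" if x: "x \<in> shift_space N A" for x i
  proof -
    have sh: "(shift ^^ i) x \<in> shift_space N A"
      using x by (auto simp: shift_space_def funpow_shift)
    have "(shift ^^ i) x \<in> cylinder N A w \<longleftrightarrow> w = [x i, x (Suc i)]" if "w \<in> G" for w
    proof -
      obtain a b where w: "w = [a, b]"
        using G \<open>w \<in> G\<close> by (auto simp: length_Suc_conv numeral_2_eq_2)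
      show ?thesis
        using sh by (auto simp: cylinder_def w funpow_shift less_Suc_eq)
    qed
    then have "(shift ^^ i) x \<in> hole N A G \<longleftrightarrow> [x i, x (Suc i)] \<in> G"
      by (auto simp: hole_def)
    moreover have "allowed_word N A [x i, x (Suc i)]"
      unfolding allowed_word_def using x
      by (intro bexI[of _ x] exI[of _ i]) (auto simp: less_Suc_eq)
    ultimately show ?thesis
      by (simp add: hole_matrix_def)
  qed
  then show ?thesis
    unfolding survivor_def by blast
qed

lemma hole_matrix_allowed:
  assumes "hole_matrix N A G i j = 1"
  shows "A i j = 1"
proof -
  have "allowed_word N A [i, j]"
    using assms by (auto simp: hole_matrix_def split: if_splits)
  then obtain x n where x: "x \<in> shift_space N A" "\<forall>k<2. x (n + k) = [i, j] ! k"
    by (auto simp: allowed_word_def numeral_2_eq_2)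
  have "x n = i" "x (Suc n) = j"
    using x(2)[rule_format, of 0] x(2)[rule_format, of 1] by (auto simp: One_nat_def)
  then show ?thesis
    using x(1) by (auto simp: shift_space_def)
qed

text \<open>Times \<open>0\<close> to \<open>m\<close> inspect \<open>m + 1\<close> edges, hence
  \<open>m + 2\<close> letters, and the survivor set is a disjoint union of cylinders of that
  length. The sum may run over all words because a forbidden edge makes the weight zero.\<close>

lemma measure_survivor:
  assumes P_stoch: "row_stochastic N P" and p_stat: "stationary_vector N P p"
    and mu: "markov_measure N A P p \<mu>" and G: "\<forall>w\<in>G. length w = 2"
  shows "measure \<mu> (survivor N A G m)
    = (\<Sum>w\<in>words {1..N} (Suc (Suc m)). p (w ! 0) * path_weight (edge_matrix P (hole_matrix N A G)) w)"
proof -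
  interpret full_shift_prob \<mu> N
    using mu by (simp add: markov_measure_def full_shift_prob_def full_shift_prob_axioms_def)
  let ?I = "words {1..N} (Suc (Suc m))"
  let ?H = "hole_matrix N A G"
  let ?D = "{w \<in> ?I. \<forall>i\<le>m. ?H (w ! i) (w ! Suc i) = 1}"
  have cyl: "cylinder N A w = shift_space N A \<inter> (prefix_word (Suc (Suc m)) -` {w} \<inter> space \<mu>)" if "w \<in> ?I" for w
    using prefix_word_eq_iff[OF length_words[OF that]] length_words[OF that]
    by (auto simp: cylinder_def space_nu shift_space_def)
  have "survivor N A G m = (\<Union>w\<in>?D. cylinder N A w)"
  proof (rule set_eqI)
    fix x
    show "x \<in> survivor N A G m \<longleftrightarrow> x \<in> (\<Union>w\<in>?D. cylinder N A w)"
    proof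
      assume x: "x \<in> survivor N A G m"
      then have xA: "x \<in> shift_space N A"
        by (simp add: survivor_def)
      have "prefix_word (Suc (Suc m)) x \<in> ?I"
        using xA by (auto simp: words_def prefix_word_def shift_space_def)
      then have "prefix_word (Suc (Suc m)) x \<in> ?D"
        using x by (simp add: survivor_eq[OF G])
      moreover have "x \<in> cylinder N A (prefix_word (Suc (Suc m)) x)"
        using xA by (simp add: cylinder_def)
      ultimately show "x \<in> (\<Union>w\<in>?D. cylinder N A w)"
        by blast
    next
      assume "x \<in> (\<Union>w\<in>?D. cylinder N A w)"
      then obtain w where w: "w \<in> ?I" "\<forall>i\<le>m. ?H (w ! i) (w ! Suc i) = 1" "x \<in> cylinder N A w"
        by blast
      have "x i = w ! i" if "i < Suc (Suc m)" for i
        using w(3) that length_words[OF w(1)] by (simp add: cylinder_def)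
      then show "x \<in> survivor N A G m"
        using w by (simp add: survivor_eq[OF G] cylinder_def)
    qed
  qed
  then have "prob (survivor N A G m) = prob (\<Union>w\<in>?D. cylinder N A w)"
    by (rule arg_cong)
  also have "\<dots> = (\<Sum>w\<in>?D. prob (cylinder N A w))"
  proof (rule finite_measure_finite_Union)
    show "finite ?D"
      by simp
    show "cylinder N A ` ?D \<subseteq> events"
      using cyl prefix_fibre sets_shift_space by auto
    show "disjoint_family_on (cylinder N A) ?D"
      using cyl by (auto simp: disjoint_family_on_def)
  qed
  also have "\<dots> = (\<Sum>w\<in>?D. p (w ! 0) * path_weight (edge_matrix P ?H) w)"
  proof (rule sum.cong[OF refl])
    fix w assume w: "w \<in> ?D"
    then have wI: "w \<in> ?I"
      by simp
    have "w \<noteq> []"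
      using length_words[OF wI] by auto
    moreover have "set w \<subseteq> {1..N}"
      using wI by (simp add: words_def)
    ultimately have "emeasure \<mu> (cylinder N A w) = ennreal (p (w ! 0) * path_weight P w)"
      using mu unfolding markov_measure_def path_weight_def by blast
    moreover have "0 \<le> p (w ! 0) * path_weight P w"
    proof (intro mult_nonneg_nonneg path_weight_nonneg[OF _ wI])
      show "0 \<le> p (w ! 0)"
        using p_stat nth_words[OF wI, of 0] by (simp add: stationary_vector_def)
      show "0 \<le> P i j" if "i \<in> {1..N}" "j \<in> {1..N}" for i j
        using P_stoch that by (auto simp: row_stochastic_def)
    qed
    moreover have "path_weight (edge_matrix P ?H) w = path_weight P w"
      unfolding path_weight_def using w length_words[OF wI]
      by (intro prod.cong refl) (auto simp: edge_matrix_def)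
    ultimately show "prob (cylinder N A w) = p (w ! 0) * path_weight (edge_matrix P ?H) w"
      by (simp add: measure_def)
  qed
  also have "\<dots> = (\<Sum>w\<in>?I. p (w ! 0) * path_weight (edge_matrix P ?H) w)"
  proof (rule sum.mono_neutral_left)
    show "\<forall>w\<in>?I - ?D. p (w ! 0) * path_weight (edge_matrix P ?H) w = 0"
    proof
      fix w assume "w \<in> ?I - ?D"
      then obtain i where i: "w \<in> ?I" "i \<le> m" "?H (w ! i) (w ! Suc i) \<noteq> 1"
        by blast
      then have "path_weight (edge_matrix P ?H) w = 0"
        unfolding path_weight_def length_words[OF i(1)]
        by (intro prod_zero bexI[of _ i]) (auto simp: edge_matrix_def)
      then show "p (w ! 0) * path_weight (edge_matrix P ?H) w = 0"
        by simp
    qed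
  qed auto
  finally show ?thesis .
qed

lemma pressure_subshift_eq_0:
  assumes "row_stochastic N P" and supp: "\<forall>i\<in>{1..N}. \<forall>j\<in>{1..N}. P i j > 0 \<longleftrightarrow> A i j = 1" and N: "1 \<le> N"
  shows "pressure N (shift_space N A) (\<lambda>x. ln (P (x 0) (x 1))) = 0"
proof -
  interpret weighted_shift N P A
    using assms by unfold_locales auto
  \<comment> \<open>Outside the support of \<open>A\<close> the nonnegative entry
    \<open>P i j\<close> is not positive, so it is already \<open>0\<close> and the restriction
    changes nothing on the alphabet.\<close>
  have W: "W i j = P i j" if "i \<in> {1..N}" "j \<in> {1..N}" for i j
    using supp P_stoch that by (force simp: edge_matrix_def row_stochastic_def)
  have Z: "Z n = real N" for n
  proof (induction n)
    case (Suc n)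
    have "(\<Sum>a\<in>{1..N}. W i a) = 1" if "i \<in> {1..N}" for i
    proof -
      have "(\<Sum>a\<in>{1..N}. W i a) = (\<Sum>a\<in>{1..N}. P i a)"
        using that by (intro sum.cong refl W)
      then show ?thesis
        using P_stoch that by (simp add: row_stochastic_def)
    qed
    then have "Z (Suc n) = (\<Sum>w\<in>words {1..N} (Suc n). path_weight W w * 1)"
      unfolding partition_function_Suc using nth_words[of _ "{1..N}" "Suc n" n]
      by (intro sum.cong refl arg_cong2[where f = "(*)"]) blast+
    then show ?case
      using Suc by (simp add: partition_function_def)
  qed simp
  have "\<exists>L. (\<lambda>n. ln (Z n) / real n) \<longlonglongrightarrow> L \<and> pressure N Y \<phi> = ereal L"
    using N by (intro pressure_eq_lim) (simp_all add: Z)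
  then obtain L where L: "(\<lambda>n. ln (Z n) / real n) \<longlonglongrightarrow> L" "pressure N Y \<phi> = ereal L"
    by blast
  have "L = 0"
    using L(1) unfolding Z by (rule LIMSEQ_unique) (rule lim_const_over_n)
  then show ?thesis
    using L(2) by (simp add: zero_ereal_def)
qed

lemma pressure_empty: "pressure N {} \<phi> = - \<infinity>"
proof -
  have "invariant_measures_on N {} = {}"
    by (auto simp: invariant_measures_on_def)
  then show ?thesis
    by (simp add: pressure_def bot_ereal_def)
qed

theorem theorem3p6:
  fixes N :: nat and A P :: "nat \<Rightarrow> nat \<Rightarrow> real" and p :: "nat \<Rightarrow> real"
    and \<mu> :: "(nat \<Rightarrow> nat) measure" and G :: "nat list set"
  assumes A01: "zero_one_matrix N A"
    and A_irr: "irreducible_matrix N A"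
    and P_stoch: "row_stochastic N P"
    and P_supp: "\<forall>i\<in>{1..N}. \<forall>j\<in>{1..N}. P i j > 0 \<longleftrightarrow> A i j = 1"
    and p_stat: "stationary_vector N P p"
    and mu: "markov_measure N A P p \<mu>"
    and G_fin: "finite G" and G_ne: "G \<noteq> {}"
    and G_words: "\<forall>w\<in>G. length w = 2 \<and> allowed_word N A w"
  shows "((\<lambda>m. escape_seq \<mu> (survivor N A G m) / ereal (real m)) \<longlongrightarrow>
           pressure N (shift_space N A) (\<lambda>x. ln (P (x 0) (x 1)))
         - pressure N (shift_space N (hole_matrix N A G)) (\<lambda>x. ln (P (x 0) (x 1))))
         sequentially"
proof -
  \<comment> \<open>Over an empty alphabet the stationary vector could not have total mass
    \<open>1\<close>.\<close>
  have N: "1 \<le> N"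
  proof (rule ccontr)
    assume "\<not> 1 \<le> N"
    then have "(\<Sum>i\<in>{1..N}. p i) = 0"
      by simp
    then show False
      using p_stat by (simp add: stationary_vector_def)
  qed
  interpret weighted_shift N P "hole_matrix N A G"
    using P_stoch P_supp hole_matrix_allowed by unfold_locales blast+
  have pressure_A: "pressure N (shift_space N A) (\<lambda>x. ln (P (x 0) (x 1))) = 0"
    by (rule pressure_subshift_eq_0[OF P_stoch P_supp N])
  \<comment> \<open>The initial factor \<open>p (w ! 0)\<close> lies between \<open>c\<close> and
    \<open>1\<close>, so the survivor measure is comparable to \<open>Z (Suc m)\<close>; positivity
    of \<open>c\<close> uses irreducibility.\<close>
  define c where "c = Min (p ` {1..N})"
  have p_pos: "0 < p j" if "j \<in> {1..N}" for j
    by (rule stationary_vector_pos[OF A01 A_irr P_stoch P_supp p_stat that])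
  have c_pos: "0 < c"
    unfolding c_def using N p_pos by (subst Min_gr_iff) auto
  have c_le: "c \<le> p j" if "j \<in> {1..N}" for j
    unfolding c_def using that by (intro Min_le) auto
  have p_le_1: "p j \<le> 1" if "j \<in> {1..N}" for j
  proof -
    have "p j \<le> (\<Sum>i\<in>{1..N}. p i)"
      using that p_pos by (intro member_le_sum) (auto intro: less_imp_le)
    then show ?thesis
      using p_stat by (simp add: stationary_vector_def)
  qed
  have surv: "measure \<mu> (survivor N A G m) = (\<Sum>w\<in>words {1..N} (Suc (Suc m)). p (w ! 0) * path_weight W w)" for m
    using G_words by (intro measure_survivor[OF P_stoch p_stat mu]) blast
  have first: "w ! 0 \<in> {1..N}" if "w \<in> words {1..N} (Suc (Suc m))" for w m
    using nth_words[OF that, of 0] by simp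
  have surv_ge: "c * Z (Suc m) \<le> measure \<mu> (survivor N A G m)" for m
    unfolding surv partition_function_def sum_distrib_left
    by (intro sum_mono mult_right_mono c_le first weight_nonneg)
  have surv_le: "measure \<mu> (survivor N A G m) \<le> Z (Suc m)" for m
  proof -
    have "measure \<mu> (survivor N A G m) \<le> (\<Sum>w\<in>words {1..N} (Suc (Suc m)). 1 * path_weight W w)"
      unfolding surv by (intro sum_mono mult_right_mono p_le_1 first weight_nonneg)
    then show ?thesis
      by (simp add: partition_function_def)
  qed
  \<comment> \<open>Either all \<open>Z n\<close> are positive and the limit is finite, or some
    \<open>Z k\<close> vanishes and both sides are \<open>\<infinity>\<close>.\<close>
  show ?thesis
  proof (cases "\<forall>n. 0 < Z n")
    case True
    then obtain L where L: "(\<lambda>n. ln (Z n) / real n) \<longlonglongrightarrow> L" "pressure N Y \<phi> = ereal L"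
      using pressure_eq_lim[OF _ N] by blast
    have pos: "0 < measure \<mu> (survivor N A G m)" for m
    proof -
      have "0 < c * Z (Suc m)"
        using c_pos True by simp
      then show ?thesis
        using surv_ge[of m] by linarith
    qed
    \<comment> \<open>The survivor set at time \<open>m\<close> involves \<open>m + 1\<close> edges
      while the escape rate divides by \<open>m\<close>; the ratio of the two tends to
      \<open>1\<close>.\<close>
    have Z_lim: "(\<lambda>m. ln (Z (Suc m)) / real m) \<longlonglongrightarrow> L"
    proof -
      have "(\<lambda>m. real (Suc m) / real m) \<longlonglongrightarrow> 1"
        by (rule LIMSEQ_Suc_n_over_n)
      then have "(\<lambda>m. (ln (Z (Suc m)) / real (Suc m)) * (real (Suc m) / real m)) \<longlonglongrightarrow> L * 1"
        using LIMSEQ_Suc[OF L(1)] by (intro tendsto_mult)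
      then show ?thesis
        by simp
    qed
    have "(\<lambda>m. ln (measure \<mu> (survivor N A G m)) / real m) \<longlonglongrightarrow> L"
    proof (rule tendsto_sandwich)
      have "(\<lambda>m. ln c / real m + ln (Z (Suc m)) / real m) \<longlonglongrightarrow> 0 + L"
        by (intro tendsto_add Z_lim lim_const_over_n)
      then show "(\<lambda>m. (ln c + ln (Z (Suc m))) / real m) \<longlonglongrightarrow> L"
        by (simp add: add_divide_distrib)
      show "(\<lambda>m. ln (Z (Suc m)) / real m) \<longlonglongrightarrow> L"
        by (rule Z_lim)
      have "ln c + ln (Z (Suc m)) \<le> ln (measure \<mu> (survivor N A G m))" for m
        using surv_ge[of m] c_pos True pos[of m] by (subst ln_mult_pos[symmetric]) auto
      then show "\<forall>\<^sub>F m in sequentially. (ln c + ln (Z (Suc m))) / real m \<le> ln (measure \<mu> (survivor N A G m)) / real m"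
        by (intro always_eventually allI divide_right_mono) auto
      have "ln (measure \<mu> (survivor N A G m)) \<le> ln (Z (Suc m))" for m
        using surv_le[of m] pos[of m] True by (intro ln_mono) auto
      then show "\<forall>\<^sub>F m in sequentially. ln (measure \<mu> (survivor N A G m)) / real m \<le> ln (Z (Suc m)) / real m"
        by (intro always_eventually allI divide_right_mono) auto
    qed
    then have "(\<lambda>m. ereal (- (ln (measure \<mu> (survivor N A G m)) / real m))) \<longlonglongrightarrow> ereal (- L)"
      by (intro tendsto_intros)
    moreover have "\<forall>\<^sub>F m in sequentially. ereal (- (ln (measure \<mu> (survivor N A G m)) / real m))
        = escape_seq \<mu> (survivor N A G m) / ereal (real m)"
      using eventually_gt_at_top[of 0]
    proof eventually_elim
      case (elim m)
      then show ?case
        using pos[of m] by (simp add: escape_seq_def)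
    qed
    ultimately have "(\<lambda>m. escape_seq \<mu> (survivor N A G m) / ereal (real m)) \<longlonglongrightarrow> ereal (- L)"
      by (rule Lim_transform_eventually)
    then show ?thesis
      unfolding pressure_A L(2) by simp
  next
    case False
    then obtain k where "Z k = 0"
      using Z_nonneg by (metis less_eq_real_def)
    \<comment> \<open>\<open>Z\<close> is antitone and nonnegative, so it vanishes from
      \<open>k\<close> on, and the survivor measure vanishes with it.\<close>
    then have zero: "measure \<mu> (survivor N A G m) = 0" if "k \<le> m" for m
      using surv_le[of m] antimonoD[OF Z_antimono, of k "Suc m"] that
      by (simp add: antisym)
    \<comment> \<open>A point of \<open>Y\<close> would supply a word of positive weight with
      \<open>k\<close> edges. The pressure of the empty set is \<open>- \<infinity>\<close>, so the
      difference of pressures is \<open>\<infinity>\<close>, like the escape rate.\<close>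
    have "Y = {}"
      using Z_pos[of _ k] \<open>Z k = 0\<close> by force
    then have pressure_B: "pressure N Y \<phi> = - \<infinity>"
      by (simp add: pressure_empty)
    have "\<forall>\<^sub>F m in sequentially. escape_seq \<mu> (survivor N A G m) / ereal (real m) = \<infinity>"
      using eventually_ge_at_top[of k] eventually_gt_at_top[of 0]
      by eventually_elim (simp add: escape_seq_def zero)
    then show ?thesis
      unfolding pressure_A pressure_B by (simp add: tendsto_eventually)
  qed
qed

end
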